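(* For any class $K$ of structures, $PF\le_c K$ if and only if there is a computable Friedberg enumeration $(\mathcal{A}_n)_{n\in\omega}$ of some subclass of $K$ containing infinitely many isomorphism types.
   Context: Conventions: every structure is for a finite relational language with universe a subset of $\omega$; a class is a collection of structures for one fixed language closed under isomorphism (so subclasses are also taken closed under isomorphism). $D(\mathcal{A})$ is the atomic diagram of $\mathcal{A}$. A computable transformation from $K$ to $K'$ is a c.e. set $\Phi$ of pairs $(\alpha,\varphi)$, $\alpha$ a finite subset of the atomic diagram of a finite structure in the language of $K$, $\varphi$ an atomic sentence or negation of one in the language of $K'$, such that for every $\mathcal{A}\in K$, $\{\varphi:(\exists\alpha\subseteq D(\mathcal{A}))(\alpha,\varphi)\in\Phi\}=D(\mathcal{B})$ for some $\mathcal{B}\in K'$. A computable embedding is a computable transformation with $\mathcal{A}\cong\mathcal{A}'\iff\Phi(\mathcal{A})\cong\Phi(\mathcal{A}')$; $K\le_c K'$ means one exists. $PF$ is the class of finite prime fields (fields of prime order, in a relational language). A computable enumeration of a class $K$ is a c.e. set $\mathcal{E}$ of pairs $(n,\varphi)$ such that for each $n$, $\{\varphi:(n,\varphi)\in\mathcal{E}\}=D(\mathcal{A}_n)$ for some $\mathcal{A}_n\in K$, and every member of $K$ is isomorphic to some $\mathcal{A}_n$; it is Friedberg if each isomorphism type in $K$ is represented by exactly one $n$. *)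

theory Defs
  imports "HOL-Library.Nat_Bijection" "HOL-Computational_Algebra.Primes"
begin

datatype recf = Zf | Sf | Proj nat | Comp recf "recf list" | Prec recf recf | Mn recf

inductive eval :: "recf \<Rightarrow> nat list \<Rightarrow> nat \<Rightarrow> bool" where
  eval_Z: "eval Zf xs 0"
| eval_S: "eval Sf (x # xs) (Suc x)"
| eval_Proj: "i < length xs \<Longrightarrow> eval (Proj i) xs (xs ! i)"
| eval_Comp: "length ys = length gs \<Longrightarrow> (\<forall>i < length gs. eval (gs ! i) xs (ys ! i))
     \<Longrightarrow> eval f ys z \<Longrightarrow> eval (Comp f gs) xs z"
| eval_Prec0: "eval g xs y \<Longrightarrow> eval (Prec g h) (0 # xs) y"
| eval_PrecS: "eval (Prec g h) (n # xs) y \<Longrightarrow> eval h (n # y # xs) z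
     \<Longrightarrow> eval (Prec g h) (Suc n # xs) z"
| eval_Mn: "eval f (n # xs) 0 \<Longrightarrow> (\<forall>m < n. \<exists>k. eval f (m # xs) (Suc k))
     \<Longrightarrow> eval (Mn f) xs n"

definition ce :: "nat set \<Rightarrow> bool" where
  "ce S \<longleftrightarrow> (\<exists>f. S = {x. \<exists>y. eval f [x] y})"

text \<open>A finite relational language is a list of arities: relation symbol i (i < length L)
  has arity L ! i.\<close>
type_synonym lang = "nat list"

record struc =
  univ :: "nat set"
  rels :: "nat \<Rightarrow> nat list \<Rightarrow> bool"

definition is_struc :: "lang \<Rightarrow> struc \<Rightarrow> bool" where
  "is_struc L A \<longleftrightarrow> univ A \<noteq> {} \<and>
     (\<forall>i xs. rels A i xs \<longrightarrow> i < length L \<and> length xs = L ! i \<and> set xs \<subseteq> univ A)"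

definition iso :: "struc \<Rightarrow> struc \<Rightarrow> bool" where
  "iso A B \<longleftrightarrow> (\<exists>f. bij_betw f (univ A) (univ B) \<and>
     (\<forall>i xs. set xs \<subseteq> univ A \<longrightarrow> (rels A i xs \<longleftrightarrow> rels B i (map f xs))))"

definition is_class :: "lang \<Rightarrow> struc set \<Rightarrow> bool" where
  "is_class L K \<longleftrightarrow> (\<forall>A\<in>K. is_struc L A) \<and>
     (\<forall>A B. A \<in> K \<longrightarrow> is_struc L B \<longrightarrow> iso A B \<longrightarrow> B \<in> K)"

definition iso_rel :: "struc set \<Rightarrow> (struc \<times> struc) set" where
  "iso_rel K = {(A, B). A \<in> K \<and> B \<in> K \<and> iso A B}"

text \<open>Atomic sentences with constants naming elements of omega.\<close>
datatype atom = AEq nat nat | ARel nat "nat list"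

text \<open>A literal (True, a) is the atomic sentence a; (False, a) is its negation.\<close>
type_synonym lit = "bool \<times> atom"

fun is_atom :: "lang \<Rightarrow> nat set \<Rightarrow> atom \<Rightarrow> bool" where
  "is_atom L U (AEq a b) \<longleftrightarrow> a \<in> U \<and> b \<in> U"
| "is_atom L U (ARel i xs) \<longleftrightarrow> i < length L \<and> length xs = L ! i \<and> set xs \<subseteq> U"

fun holds :: "struc \<Rightarrow> atom \<Rightarrow> bool" where
  "holds A (AEq a b) \<longleftrightarrow> a = b"
| "holds A (ARel i xs) \<longleftrightarrow> rels A i xs"

definition diag :: "lang \<Rightarrow> struc \<Rightarrow> lit set" where
  "diag L A = {(holds A a, a) | a. is_atom L (univ A) a}"

fun atom_code :: "atom \<Rightarrow> nat" where
  "atom_code (AEq a b) = 2 * prod_encode (a, b)"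
| "atom_code (ARel i xs) = Suc (2 * prod_encode (i, list_encode xs))"

fun lit_code :: "lit \<Rightarrow> nat" where
  "lit_code (b, a) = prod_encode (if b then 1 else 0, atom_code a)"

definition litset_code :: "lit set \<Rightarrow> nat" where
  "litset_code \<alpha> = set_encode (lit_code ` \<alpha>)"

definition image_diag :: "lang \<Rightarrow> (lit set \<times> lit) set \<Rightarrow> struc \<Rightarrow> lit set" where
  "image_diag L \<Phi> A = {\<phi>. \<exists>\<alpha>. \<alpha> \<subseteq> diag L A \<and> (\<alpha>, \<phi>) \<in> \<Phi>}"

definition comp_transformation ::
  "lang \<Rightarrow> struc set \<Rightarrow> lang \<Rightarrow> struc set \<Rightarrow> (lit set \<times> lit) set \<Rightarrow> bool" where
  "comp_transformation L K L' K' \<Phi> \<longleftrightarrow>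
     ce ((\<lambda>(\<alpha>, \<phi>). prod_encode (litset_code \<alpha>, lit_code \<phi>)) ` \<Phi>) \<and>
     (\<forall>(\<alpha>, \<phi>) \<in> \<Phi>. finite \<alpha> \<and>
        (\<exists>B. is_struc L B \<and> finite (univ B) \<and> \<alpha> \<subseteq> diag L B) \<and>
        is_atom L' UNIV (snd \<phi>)) \<and>
     (\<forall>A\<in>K. \<exists>B\<in>K'. image_diag L \<Phi> A = diag L' B)"

definition comp_embedding ::
  "lang \<Rightarrow> struc set \<Rightarrow> lang \<Rightarrow> struc set \<Rightarrow> (lit set \<times> lit) set \<Rightarrow> bool" where
  "comp_embedding L K L' K' \<Phi> \<longleftrightarrow> comp_transformation L K L' K' \<Phi> \<and>
     (\<forall>A\<in>K. \<forall>A'\<in>K. \<forall>B\<in>K'. \<forall>B'\<in>K'.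
        image_diag L \<Phi> A = diag L' B \<longrightarrow> image_diag L \<Phi> A' = diag L' B' \<longrightarrow>
        (iso A A' \<longleftrightarrow> iso B B'))"

definition comp_reducible :: "lang \<Rightarrow> struc set \<Rightarrow> lang \<Rightarrow> struc set \<Rightarrow> bool" where
  "comp_reducible L K L' K' \<longleftrightarrow> (\<exists>\<Phi>. comp_embedding L K L' K' \<Phi>)"

definition enum_section :: "(nat \<times> lit) set \<Rightarrow> nat \<Rightarrow> lit set" where
  "enum_section E n = {\<phi>. (n, \<phi>) \<in> E}"

definition comp_enumeration :: "lang \<Rightarrow> struc set \<Rightarrow> (nat \<times> lit) set \<Rightarrow> bool" where
  "comp_enumeration L K E \<longleftrightarrow>
     ce ((\<lambda>(n, \<phi>). prod_encode (n, lit_code \<phi>)) ` E) \<and>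
     (\<forall>n. \<exists>A\<in>K. enum_section E n = diag L A) \<and>
     (\<forall>A\<in>K. \<exists>n. \<exists>B\<in>K. enum_section E n = diag L B \<and> iso B A)"

definition friedberg_enumeration :: "lang \<Rightarrow> struc set \<Rightarrow> (nat \<times> lit) set \<Rightarrow> bool" where
  "friedberg_enumeration L K E \<longleftrightarrow> comp_enumeration L K E \<and>
     (\<forall>n m. \<forall>A\<in>K. \<forall>B\<in>K. enum_section E n = diag L A \<longrightarrow> enum_section E m = diag L B \<longrightarrow>
        iso A B \<longrightarrow> n = m)"

text \<open>Relational language of rings: graph of +, graph of *, unary relations for 0 and 1.\<close>
definition L_PF :: lang where
  "L_PF = [3, 3, 1, 1]"

definition Zp :: "nat \<Rightarrow> struc" where
  "Zp p = \<lparr> univ = {..<p},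
     rels = (\<lambda>i xs. set xs \<subseteq> {..<p} \<and>
       (if i = 0 then length xs = 3 \<and> xs ! 2 = (xs ! 0 + xs ! 1) mod p
        else if i = 1 then length xs = 3 \<and> xs ! 2 = (xs ! 0 * xs ! 1) mod p
        else if i = 2 then xs = [0]
        else if i = 3 then xs = [1]
        else False)) \<rparr>"

definition PF :: "struc set" where
  "PF = {A. is_struc L_PF A \<and> (\<exists>p::nat. prime p \<and> iso A (Zp p))}"

end

theory Submission
  imports Defs
begin

text \<open>
  If \<open>\<Phi>\<close> is a computable embedding of the finite prime fields into \<open>K\<close>, then the structures
  \<open>\<Phi>(Z\<^sub>p)\<close>, with \<open>p\<close> running through the primes in increasing order, are pairwise
  non-isomorphic and uniformly c.e., hence form a Friedberg enumeration of their closure under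
  isomorphism. Conversely, let \<open>(A\<^sub>n)\<close> be a Friedberg enumeration. A field of prime order \<open>q\<close>
  contains a finite positive certificate that \<open>p \<cdot> 1 = 0\<close>, for a prime \<open>p\<close>, exactly if \<open>q = p\<close>;
  so listing the diagram of \<open>A\<^sub>p\<close> whenever such a certificate has been seen is a computable
  embedding.

  Computability of all sets involved is derived from closure properties of the c.e. predicates
  (conjunction, disjunction, existential and bounded universal quantification).
  Closure under existential quantification needs dovetailing, which is
  based on a stage-bounded evaluation function defined by recursion on the program.
\<close>

section \<open>Computable functions and c.e. predicates\<close>

subsection \<open>Total computable functions\<close>

text \<open>Variables are modelled by an environment \<open>e :: nat \<Rightarrow> nat\<close>, of which only
  \<open>e 0, \<dots>, e (n - 1)\<close> are passed to the program; binding a variable shifts the environment.\<close>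

definition computable :: "nat \<Rightarrow> ((nat \<Rightarrow> nat) \<Rightarrow> nat) \<Rightarrow> bool" where
  "computable n F \<longleftrightarrow> (\<exists>f. \<forall>e. eval f (map e [0..<n]) (F e))"

lemma computable_var: "i < n \<Longrightarrow> computable n (\<lambda>e. e i)"
  unfolding computable_def
  by (rule exI[of _ "Proj i"]) (use eval_Proj[of i "map e [0..<n]" for e] in auto)

text \<open>Composition of programs, phrased as substitution into the environment. With projections
  for \<open>S\<close> it also renames, drops and rearranges variables.\<close>

lemma computable_subst:
  assumes G: "computable m G" and S: "\<And>i. i < m \<Longrightarrow> computable n (S i)"
  shows "computable n (\<lambda>e. G (\<lambda>i. S i e))"
proof -
  obtain f where f: "\<And>e. eval f (map e [0..<m]) (G e)"
    using G unfolding computable_def by blast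
  have "\<forall>i. \<exists>g. i < m \<longrightarrow> (\<forall>e. eval g (map e [0..<n]) (S i e))"
    using S unfolding computable_def by blast
  then obtain g where g: "\<And>i e. i < m \<Longrightarrow> eval (g i) (map e [0..<n]) (S i e)"
    by metis
  have "eval (Comp f (map g [0..<m])) (map e [0..<n]) (G (\<lambda>i. S i e))" for e
    by (rule eval_Comp[where ys = "map (\<lambda>i. S i e) [0..<m]"]) (use f g in auto)
  then show ?thesis unfolding computable_def by blast
qed

lemma computable_Suc:
  assumes "computable n F" shows "computable n (\<lambda>e. Suc (F e))"
proof -
  have "computable 1 (\<lambda>e. Suc (e 0))"
    unfolding computable_def by (rule exI[of _ Sf]) (auto intro: eval_S)
  from computable_subst[OF this, of n "\<lambda>_. F"] show ?thesis using assms by simp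
qed

lemma computable_const: "computable n (\<lambda>e. c)"
proof (induction c)
  case 0 show ?case
    unfolding computable_def by (rule exI[of _ Zf]) (auto intro: eval_Z)
qed (rule computable_Suc)

text \<open>\<open>Prec\<close> recurses on its first argument, so the recursion is first realised
  up to a fresh variable 0, for which \<open>N\<close> is then substituted. Inside the step,
  variables 0 and 1 are the counter and the previous value, and the outer variables move up by
  two.\<close>

lemma computable_rec:
  assumes a: "computable n a" and h: "computable (Suc (Suc n)) (\<lambda>e. h (e 0) (e (Suc 0)) (\<lambda>i. e (Suc (Suc i))))"
    and N: "computable n N"
  shows "computable n (\<lambda>e. rec_nat (a e) (\<lambda>k r. h k r e) (N e))"
proof -
  obtain fa where fa: "\<And>e. eval fa (map e [0..<n]) (a e)"
    using a unfolding computable_def by blast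
  obtain fh where fh: "\<And>e. eval fh (map e [0..<Suc (Suc n)]) (h (e 0) (e (Suc 0)) (\<lambda>i. e (Suc (Suc i))))"
    using h unfolding computable_def by blast
  \<comment> \<open>\<open>case_nat k e\<close> is the environment \<open>e\<close> with
    \<open>k\<close> prepended.\<close>
  have step: "eval fh (k # r # map e [0..<n]) (h k r e)" for k r e
    using fh[of "case_nat k (case_nat r e)"] by (simp add: map_upt_Suc del: upt_Suc)
  have "eval (Prec fa fh) (k # map e [0..<n]) (rec_nat (a e) (\<lambda>k r. h k r e) k)" for k e
    by (induction k) (auto intro: eval_Prec0 eval_PrecS fa step)
  then have 1: "computable (Suc n) (\<lambda>e. rec_nat (a (\<lambda>i. e (Suc i))) (\<lambda>k r. h k r (\<lambda>i. e (Suc i))) (e 0))"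
    unfolding computable_def
    by (intro exI[of _ "Prec fa fh"]) (simp add: map_upt_Suc del: upt_Suc)
  have "computable n (case i of 0 \<Rightarrow> N | Suc j \<Rightarrow> \<lambda>e. e j)" if "i < Suc n" for i
    using that N by (cases i) (auto intro: computable_var)
  from computable_subst[OF 1, of n "\<lambda>i. case i of 0 \<Rightarrow> N | Suc j \<Rightarrow> \<lambda>e. e j", OF this]
  show ?thesis by simp
qed

lemma computable_app1:
  assumes "computable 1 (\<lambda>e. g (e 0))" "computable n F"
  shows "computable n (\<lambda>e. g (F e))"
  using computable_subst[OF assms(1), of n "\<lambda>_. F"] assms(2) by simp

lemma computable_app2:
  assumes "computable 2 (\<lambda>e. g (e 0) (e (Suc 0)))" "computable n F" "computable n G"
  shows "computable n (\<lambda>e. g (F e) (G e))"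
  using computable_subst[OF assms(1), of n "\<lambda>i. if i = 0 then F else G"] assms(2,3) by simp

text \<open>A recursion on \<open>F e\<close> whose step ignores the counter and the previous value
  separates zero from the successors.\<close>

lemma computable_if_zero:
  assumes "computable n F" "computable n G" "computable n H"
  shows "computable n (\<lambda>e. if F e = 0 then G e else H e)"
proof -
  have "computable n (\<lambda>e. rec_nat (G e) (\<lambda>k r. H e) (F e))"
    by (rule computable_rec[where h="\<lambda>k r. H"])
      (use assms computable_subst[of n H "Suc (Suc n)" "\<lambda>i e. e (Suc (Suc i))"] in \<open>auto intro: computable_var\<close>)
  moreover have "rec_nat (G e) (\<lambda>k r. H e) (F e) = (if F e = 0 then G e else H e)" for e
    by (cases "F e") auto
  ultimately show ?thesis by simp
qed

lemma computable_pred: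
  assumes "computable n F" shows "computable n (\<lambda>e. F e - 1)"
proof -
  have "computable 1 (\<lambda>e. rec_nat 0 (\<lambda>k r. k) (e 0))"
    by (rule computable_rec[where h="\<lambda>k r e. k"] computable_const computable_var | simp)+
  moreover have "rec_nat 0 (\<lambda>k r. k) m = m - 1" for m :: nat by (cases m) auto
  ultimately have "computable 1 (\<lambda>e. e 0 - 1)" by simp
  from computable_app1[OF this assms] show ?thesis .
qed

lemma computable_add:
  assumes "computable n F" "computable n G" shows "computable n (\<lambda>e. F e + G e)"
proof -
  have "computable n (\<lambda>e. rec_nat (F e) (\<lambda>k r. Suc r) (G e))"
    by (rule computable_rec[where h="\<lambda>k r e. Suc r"]) (use assms in \<open>auto intro: computable_Suc computable_var\<close>)
  moreover have "rec_nat a (\<lambda>k r. Suc r) b = a + b" for a b by (induction b) auto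
  ultimately show ?thesis by simp
qed

lemma computable_diff:
  assumes "computable n F" "computable n G" shows "computable n (\<lambda>e. F e - G e)"
proof -
  have "computable n (\<lambda>e. rec_nat (F e) (\<lambda>k r. r - 1) (G e))"
    by (rule computable_rec[where h="\<lambda>k r e. r - 1"]) (use assms in \<open>auto intro!: computable_pred[simplified] computable_var\<close>)
  moreover have "rec_nat a (\<lambda>k r. r - 1) b = a - b" for a b :: nat by (induction b) auto
  ultimately show ?thesis by simp
qed

lemma computable_mult:
  assumes "computable n F" "computable n G" shows "computable n (\<lambda>e. F e * G e)"
proof -
  have "computable 2 (\<lambda>e. rec_nat 0 (\<lambda>k r. r + e 0) (e (Suc 0)))"
    by (rule computable_rec[where h="\<lambda>k r e. r + e 0"] computable_add computable_const computable_var | simp)+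
  moreover have "rec_nat 0 (\<lambda>k r. r + a) b = a * b" for a b :: nat by (induction b) auto
  ultimately have "computable 2 (\<lambda>e. e 0 * e (Suc 0))" by simp
  from computable_app2[OF this assms] show ?thesis .
qed

lemma computable_pow2:
  assumes "computable n F" shows "computable n (\<lambda>e. 2 ^ F e)"
proof -
  have "computable n (\<lambda>e. rec_nat 1 (\<lambda>k r. r + r) (F e))"
    by (rule computable_rec[where h="\<lambda>k r e. r + r"]) (use assms in \<open>auto intro: computable_const computable_add computable_var\<close>)
  moreover have "rec_nat 1 (\<lambda>k r. r + r) b = (2::nat) ^ b" for b by (induction b) auto
  ultimately show ?thesis by simp
qed

lemma computable_triangle:
  assumes "computable n F" shows "computable n (\<lambda>e. triangle (F e))"
proof -
  have "computable n (\<lambda>e. rec_nat 0 (\<lambda>k r. r + Suc k) (F e))"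
    by (rule computable_rec[where h="\<lambda>k r e. r + Suc k"])
      (use assms in \<open>auto intro!: computable_const computable_Suc computable_add computable_var simp del: add_Suc_right\<close>)
  moreover have "rec_nat 0 (\<lambda>k r. r + Suc k) b = triangle b" for b by (induction b) auto
  ultimately show ?thesis by simp
qed

lemma computable_prod_encode:
  assumes "computable n F" "computable n G" shows "computable n (\<lambda>e. prod_encode (F e, G e))"
  unfolding prod_encode_def by (simp add: computable_add computable_triangle assms)

lemmas computable_intros =
  computable_var computable_const computable_Suc computable_add computable_diff computable_mult computable_pow2 computable_prod_encode

subsection \<open>Decoding pairs and lists\<close>

text \<open>The diagonal of the Cantor pairing on which \<open>z\<close> lies: the largest
  \<open>r\<close> with \<open>triangle r \<le> z\<close>. The truncated difference adds 1 exactly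
  when \<open>Suc z\<close> reaches the next triangular number.\<close>

primrec tri_root :: "nat \<Rightarrow> nat" where
  "tri_root 0 = 0"
| "tri_root (Suc z) = tri_root z + (1 - (triangle (Suc (tri_root z)) - Suc z))"

lemma tri_root_bounds: "triangle (tri_root z) \<le> z \<and> z < triangle (Suc (tri_root z))"
proof (induction z)
  case (Suc z)
  then show ?case
    by (cases "triangle (Suc (tri_root z)) \<le> Suc z") (auto simp: not_le Suc_diff_le)
qed simp

text \<open>\<open>prod_encode (a, b)\<close> is \<open>triangle (a + b) + a\<close>, so
  \<open>a\<close> is the excess over the triangular number and \<open>b\<close> is what remains of
  the diagonal index.\<close>

definition pfst :: "nat \<Rightarrow> nat" where "pfst z = z - triangle (tri_root z)"
definition psnd :: "nat \<Rightarrow> nat" where "psnd z = tri_root z - pfst z"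

lemma prod_encode_pfst_psnd: "prod_encode (pfst z, psnd z) = z"
  using tri_root_bounds[of z] unfolding prod_encode_def pfst_def psnd_def by auto

lemma pfst_prod_encode [simp]: "pfst (prod_encode (a, b)) = a"
  and psnd_prod_encode [simp]: "psnd (prod_encode (a, b)) = b"
  using prod_encode_pfst_psnd[of "prod_encode (a, b)"] by auto

lemma computable_tri_root:
  assumes "computable n F" shows "computable n (\<lambda>e. tri_root (F e))"
proof -
  have "computable n (\<lambda>e. rec_nat 0 (\<lambda>k r. r + (1 - (triangle (Suc r) - Suc k))) (F e))"
    by (rule computable_rec[where h="\<lambda>k r e. r + (1 - (triangle (Suc r) - Suc k))"])
      (intro computable_intros computable_triangle assms; simp)+
  moreover have "rec_nat 0 (\<lambda>k r. r + (1 - (triangle (Suc r) - Suc k))) b = tri_root b" for b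
    by (induction b) auto
  ultimately show ?thesis by simp
qed

lemma computable_pfst: "computable n F \<Longrightarrow> computable n (\<lambda>e. pfst (F e))"
  unfolding pfst_def by (intro computable_intros computable_triangle computable_tri_root)

lemma computable_psnd: "computable n F \<Longrightarrow> computable n (\<lambda>e. psnd (F e))"
  unfolding psnd_def by (intro computable_intros computable_pfst computable_tri_root)

text \<open>\<open>list_encode (x # xs)\<close> is the successor of a pair, hence the subtractions
  of 1. Every number \<open>u\<close> yields a total function, so codes can be quantified over
  without checking a length.\<close>

definition nth_code :: "nat \<Rightarrow> nat \<Rightarrow> nat" where
  "nth_code u i = pfst (rec_nat u (\<lambda>k r. psnd (r - 1)) i - 1)"

lemma nth_code_list_encode: "i < length xs \<Longrightarrow> nth_code (list_encode xs) i = xs ! i"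
proof -
  have "i \<le> length xs \<Longrightarrow> rec_nat (list_encode xs) (\<lambda>k r. psnd (r - 1)) i = list_encode (drop i xs)" for i
    by (induction i) (auto simp: Cons_nth_drop_Suc[symmetric])
  then show "i < length xs \<Longrightarrow> nth_code (list_encode xs) i = xs ! i"
    by (simp add: nth_code_def Cons_nth_drop_Suc[symmetric])
qed

lemma computable_nth_code:
  assumes "computable n F" "computable n G" shows "computable n (\<lambda>e. nth_code (F e) (G e))"
  unfolding nth_code_def
  by (intro computable_pfst computable_diff computable_const computable_rec[where h="\<lambda>k r e. psnd (r - 1)"] computable_psnd computable_var assms) simp

subsection \<open>Stage-bounded evaluation\<close>

text \<open>The value \<open>0\<close> means that there is no result at stage \<open>t\<close>, and \<open>Suc y\<close> that the
  result is \<open>y\<close>. In the search for \<open>Mn\<close>, the state is \<open>0\<close> while searching, \<open>1\<close> after an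
  undefined value, and \<open>k + 2\<close> once the zero \<open>k\<close> is found.\<close>

fun bev :: "recf \<Rightarrow> nat \<Rightarrow> nat list \<Rightarrow> nat" where
  "bev Zf t xs = 1"
| "bev Sf t xs = (case xs of [] \<Rightarrow> 0 | x # _ \<Rightarrow> Suc (Suc x))"
| "bev (Proj i) t xs = (if i < length xs then Suc (xs ! i) else 0)"
| "bev (Comp f gs) t xs = (if prod_list (map (\<lambda>g. bev g t xs) gs) = 0 then 0
     else bev f t (map (\<lambda>g. bev g t xs - 1) gs))"
| "bev (Prec g h) t xs = (case xs of [] \<Rightarrow> 0 | n # ys \<Rightarrow>
     rec_nat (bev g t ys) (\<lambda>k r. if r = 0 then 0 else bev h t (k # (r - 1) # ys)) n)"
| "bev (Mn f) t xs = rec_nat 0 (\<lambda>k r. if r = 0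
     then (if bev f t (k # xs) = 0 then 1 else if bev f t (k # xs) - 1 = 0 then k + 2 else 0)
     else r) t - 1"

lemma bev_sound: "bev f t xs = Suc y \<Longrightarrow> eval f xs y"
proof (induction f arbitrary: xs y)
  case (Comp f gs)
  have "prod_list (map (\<lambda>g. bev g t xs) gs) \<noteq> 0"
    using Comp.prems by (auto split: if_splits)
  then have nz: "bev g t xs \<noteq> 0" if "g \<in> set gs" for g
    using that unfolding prod_list_zero_iff by force
  have "bev f t (map (\<lambda>g. bev g t xs - 1) gs) = Suc y"
    using Comp.prems by (auto split: if_splits)
  then have "eval f (map (\<lambda>g. bev g t xs - 1) gs) y" by (rule Comp.IH(1))
  moreover have "eval g xs (bev g t xs - 1)" if "g \<in> set gs" for g
    by (rule Comp.IH(2)) (use that nz[OF that] in auto)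
  ultimately show ?case
    by (intro eval_Comp[where ys = "map (\<lambda>g. bev g t xs - 1) gs"]) auto
next
  case (Prec g h)
  obtain n ys where xs: "xs = n # ys" using Prec.prems by (cases xs) auto
  define R where "R = rec_nat (bev g t ys) (\<lambda>k r. if r = 0 then 0 else bev h t (k # (r - 1) # ys))"
  have "R k = Suc z \<Longrightarrow> eval (Prec g h) (k # ys) z" for k z
  proof (induction k arbitrary: z)
    case 0
    then show ?case by (auto simp: R_def intro: eval_Prec0 Prec.IH(1))
  next
    case (Suc k)
    then obtain w where w: "R k = Suc w" by (cases "R k") (auto simp: R_def)
    then have "bev h t (k # w # ys) = Suc z" using Suc.prems by (auto simp: R_def)
    then show ?case using Suc.IH[OF w] by (intro eval_PrecS Prec.IH(2))
  qed
  then show ?case using Prec.prems by (auto simp: xs R_def)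
next
  case (Mn f)
  define R where "R = rec_nat 0 (\<lambda>k r. if r = 0
     then (if bev f t (k # xs) = 0 then 1 else if bev f t (k # xs) - 1 = 0 then k + 2 else 0)
     else r)"
  \<comment> \<open>Invariant of the search through the first \<open>k\<close> arguments. State 1
    carries no claim: the search has met a value that is undefined at stage
    \<open>t\<close>.\<close>
  have "(R k = 0 \<longrightarrow> (\<forall>m<k. \<exists>j. eval f (m # xs) (Suc j))) \<and>
        (R k = Suc (Suc z) \<longrightarrow> eval (Mn f) xs z)" for k z
  proof (induction k arbitrary: z)
    case 0
    then show ?case by (simp add: R_def)
  next
    case (Suc k)
    have step: "R (Suc k) = (if R k = 0
     then (if bev f t (k # xs) = 0 then 1 else if bev f t (k # xs) - 1 = 0 then k + 2 else 0)
     else R k)" by (simp add: R_def)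
    show ?case
    proof (cases "R k = 0")
      case True
      then have all: "\<forall>m<k. \<exists>j. eval f (m # xs) (Suc j)" using Suc.IH by blast
      consider "bev f t (k # xs) = 0" | "bev f t (k # xs) = Suc 0"
        | j where "bev f t (k # xs) = Suc (Suc j)"
        by (metis old.nat.exhaust)
      then show ?thesis
      proof cases
        case 1 then show ?thesis using step True by simp
      next
        case 2
        then have "eval (Mn f) xs k" using all by (intro eval_Mn Mn.IH)
        then show ?thesis using step True 2 by auto
      next
        case (3 j)
        then have "\<exists>j. eval f (k # xs) (Suc j)" using Mn.IH by blast
        then show ?thesis using step True 3 all by (auto simp: less_Suc_eq)
      qed
    next
      case False
      then show ?thesis using step Suc.IH by simp
    qed
  qed
  moreover have "R t = Suc (Suc y)" using Mn.prems unfolding R_def by simp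
  ultimately show ?case by blast
qed (auto intro: eval.intros split: list.splits if_splits)

text \<open>Claiming the value at all large stages lets finitely many subcomputations be combined as
  eventual properties, without choosing a common stage.\<close>

lemma bev_complete: "eval f xs y \<Longrightarrow> \<forall>\<^sub>F t in sequentially. bev f t xs = Suc y"
proof (induction rule: eval.induct)
  case (eval_Comp ys gs xs f z)
  have "\<forall>\<^sub>F t in sequentially. \<forall>i\<in>{..<length gs}. bev (gs ! i) t xs = Suc (ys ! i)"
    using eval_Comp by (intro eventually_ball_finite) auto
  with eval_Comp.IH(2) show ?case
  proof eventually_elim
    case (elim t)
    then have "map (\<lambda>g. bev g t xs) gs = map Suc ys"
      using eval_Comp.hyps by (intro nth_equalityI) auto
    moreover from this have "map (\<lambda>g. bev g t xs - 1) gs = ys"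
      using eval_Comp.hyps elim by (intro nth_equalityI) auto
    ultimately show ?case using elim by (simp add: prod_list_zero_iff)
  qed
next
  case (eval_PrecS g h n xs y z)
  from eval_PrecS.IH show ?case by eventually_elim simp
next
  case (eval_Mn f n xs)
  have "\<forall>\<^sub>F t in sequentially. \<forall>m\<in>{..<n}. \<exists>k. bev f t (m # xs) = Suc (Suc k)"
  proof (intro eventually_ball_finite ballI)
    fix m assume "m \<in> {..<n}"
    then obtain k where "\<forall>\<^sub>F t in sequentially. bev f t (m # xs) = Suc (Suc k)"
      using eval_Mn.IH by blast
    then show "\<forall>\<^sub>F t in sequentially. \<exists>k. bev f t (m # xs) = Suc (Suc k)"
      by eventually_elim blast
  qed simp
  \<comment> \<open>The search tries only arguments below the stage, so the stage has to exceed
    \<open>n\<close>.\<close>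
  with eval_Mn.IH(1) eventually_gt_at_top[of n] show ?case
  proof eventually_elim
    case (elim t)
    define R where "R = rec_nat 0 (\<lambda>k r. if r = 0
       then (if bev f t (k # xs) = 0 then 1 else if bev f t (k # xs) - 1 = 0 then k + 2 else 0)
       else r)"
    have step: "R (Suc k) = (if R k = 0
       then (if bev f t (k # xs) = 0 then 1 else if bev f t (k # xs) - 1 = 0 then k + 2 else 0)
       else R k)" for k by (simp add: R_def)
    have "m \<le> n \<Longrightarrow> R m = 0" for m
    proof (induction m)
      case (Suc m)
      then have "m \<in> {..<n}" by simp
      then obtain k where "bev f t (m # xs) = Suc (Suc k)" using elim by blast
      then show ?case using Suc by (simp add: step)
    qed (simp add: R_def)
    then have "R (Suc n) = n + 2" using elim by (simp add: step)
    then have "R (Suc n + d) = n + 2" for d by (induction d) (simp_all add: step)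
    from this[of "t - Suc n"] have "R t = n + 2" using elim by simp
    then show ?case unfolding R_def by simp
  qed
qed (auto elim: eventually_mono)

text \<open>Both results are the eventual value of the function \<open>bev\<close>.\<close>

lemma eval_deterministic:
  assumes "eval f xs y" "eval f xs z" shows "y = z"
proof -
  have "\<forall>\<^sub>F t in sequentially. Suc y = Suc z"
    using bev_complete[OF assms(1)] bev_complete[OF assms(2)] by eventually_elim simp
  then show ?thesis by simp
qed

lemma computable_prod_list:
  assumes "\<And>g. g \<in> set gs \<Longrightarrow> computable n (B g)"
  shows "computable n (\<lambda>e. prod_list (map (\<lambda>g. B g e) gs))"
  using assms by (induction gs) (auto intro: computable_const computable_mult)

text \<open>The program is fixed and only the stage \<open>e 0\<close> and the inputs vary, so
  induction on the program reduces each clause of \<open>bev\<close> to closure properties of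
  computable functions.\<close>

lemma computable_bev:
  "computable (Suc n) (\<lambda>e. bev f (e 0) (map (\<lambda>i. e (Suc i)) [0..<n]))"
proof (induction f arbitrary: n)
  case Zf
  show ?case by (simp add: computable_const)
next
  case Sf
  show ?case
    by (cases n) (auto simp: map_upt_Suc computable_const simp del: upt_Suc
        intro!: computable_Suc computable_var)
next
  case (Proj i)
  show ?case
    by (cases "i < n") (auto simp: computable_const intro!: computable_Suc computable_var)
next
  case (Comp f gs)
  define B where "B g e = bev g (e 0) (map (\<lambda>i. e (Suc i)) [0..<n])" for g and e :: "nat \<Rightarrow> nat"
  have B: "computable (Suc n) (B g)" if "g \<in> set gs" for g
    using Comp.IH(2)[OF that] unfolding B_def .
  define S where "S i = (case i of 0 \<Rightarrow> (\<lambda>e. e 0) | Suc j \<Rightarrow> (\<lambda>e. B (gs ! j) e - 1))" for i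
  have "computable (Suc n) (\<lambda>e. bev f (S 0 e) (map (\<lambda>i. S (Suc i) e) [0..<length gs]))"
    by (rule computable_subst[OF Comp.IH(1)[of "length gs"], where S=S])
      (auto simp: S_def split: nat.splits intro!: computable_var computable_pred[simplified] B)
  moreover have "map (\<lambda>i. S (Suc i) e) [0..<length gs] = map (\<lambda>g. B g e - 1) gs" for e
    by (intro nth_equalityI) (auto simp: S_def)
  ultimately have "computable (Suc n) (\<lambda>e. bev f (e 0) (map (\<lambda>g. B g e - 1) gs))"
    by (simp add: S_def)
  then have "computable (Suc n) (\<lambda>e. if prod_list (map (\<lambda>g. B g e) gs) = 0 then 0
      else bev f (e 0) (map (\<lambda>g. B g e - 1) gs))"
    by (intro computable_if_zero computable_prod_list computable_const B)
  then show ?case unfolding B_def by simp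
next
  case (Prec g h)
  show ?case
  proof (cases n)
    case 0
    then show ?thesis by (simp add: computable_const)
  next
    case (Suc m)
    have g: "computable (Suc n) (\<lambda>e. bev g (e 0) (map (\<lambda>i. e (Suc (Suc i))) [0..<m]))"
    proof -
      have "computable (Suc n) (\<lambda>e. if i = 0 then e 0 else e (Suc i))" if "i < Suc m" for i
        using that by (cases i) (auto simp: Suc intro: computable_var)
      from computable_subst[OF Prec.IH(1)[of m], where S="\<lambda>i e. if i = 0 then e 0 else e (Suc i)", OF this] show ?thesis by simp
    qed
    \<comment> \<open>Within the recursion, \<open>e 0\<close> is the counter, \<open>e 1\<close>
      the previous result in the \<open>Suc\<close> coding, \<open>e 2\<close> the stage, and
      \<open>e 3\<close> the original recursion argument, which is skipped.\<close>
    define S :: "nat \<Rightarrow> (nat \<Rightarrow> nat) \<Rightarrow> nat" where "S i = (if i = 0 then (\<lambda>e. e 2) else if i = 1 then (\<lambda>e. e 0)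
      else if i = 2 then (\<lambda>e. e 1 - 1) else (\<lambda>e. e (Suc i)))" for i
    have "computable (Suc (Suc (Suc n))) (\<lambda>e. bev h (S 0 e) (map (\<lambda>i. S (Suc i) e) [0..<Suc (Suc m)]))"
      by (rule computable_subst[OF Prec.IH(2)[of "Suc (Suc m)"], where S=S])
        (auto simp: S_def Suc intro!: computable_var computable_pred[simplified])
    then have h: "computable (Suc (Suc (Suc n))) (\<lambda>e. bev h (e 2) (e 0 # (e 1 - 1) #
        map (\<lambda>i. e (Suc (Suc (Suc (Suc i))))) [0..<m]))"
      by (simp add: S_def map_upt_Suc numeral_2_eq_2 del: upt_Suc)
    have "computable (Suc n) (\<lambda>e. rec_nat (bev g (e 0) (map (\<lambda>i. e (Suc (Suc i))) [0..<m]))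
        (\<lambda>k r. if r = 0 then 0 else bev h (e 0) (k # (r - 1) # map (\<lambda>i. e (Suc (Suc i))) [0..<m])) (e 1))"
      by (rule computable_rec[where h="\<lambda>k r e. if r = 0 then 0 else bev h (e 0) (k # (r - 1) # map (\<lambda>i. e (Suc (Suc i))) [0..<m])"])
        (use g h in \<open>auto simp: Suc numeral_2_eq_2 intro!: computable_if_zero computable_var computable_const\<close>)
    then show ?thesis by (simp add: Suc map_upt_Suc del: upt_Suc)
  qed
next
  case (Mn f)
  \<comment> \<open>The same rearrangement for the search: \<open>e 1\<close> is the search state,
    which is not an input of \<open>f\<close>.\<close>
  define S :: "nat \<Rightarrow> (nat \<Rightarrow> nat) \<Rightarrow> nat" where "S i = (if i = 0 then (\<lambda>e. e 2) else if i = 1 then (\<lambda>e. e 0)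
      else (\<lambda>e. e (Suc i)))" for i
  have "computable (Suc (Suc (Suc n))) (\<lambda>e. bev f (S 0 e) (map (\<lambda>i. S (Suc i) e) [0..<Suc n]))"
    by (rule computable_subst[OF Mn.IH[of "Suc n"], where S=S])
      (auto simp: S_def intro!: computable_var)
  then have f: "computable (Suc (Suc (Suc n))) (\<lambda>e. bev f (e 2) (e 0 #
      map (\<lambda>i. e (Suc (Suc (Suc i)))) [0..<n]))"
    by (simp add: S_def map_upt_Suc del: upt_Suc)
  define H where "H k r e = (if r = 0
     then (if bev f (e 0) (k # map (\<lambda>i. e (Suc i)) [0..<n]) = 0 then 1
       else if bev f (e 0) (k # map (\<lambda>i. e (Suc i)) [0..<n]) - 1 = 0 then k + 2 else 0)
     else r)" for k r :: nat and e
  have "computable (Suc (Suc (Suc n))) (\<lambda>e. H (e 0) (e (Suc 0)) (\<lambda>i. e (Suc (Suc i))))"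
    unfolding H_def
    by (intro computable_if_zero computable_intros computable_pred)
      (use f in \<open>simp_all add: numeral_2_eq_2\<close>)
  then have "computable (Suc n) (\<lambda>e. rec_nat 0 (\<lambda>k r. H k r e) (e 0) - 1)"
    by (intro computable_pred computable_rec computable_const computable_var) auto
  then show ?case by (simp add: H_def)
qed

subsection \<open>Recursively enumerable predicates\<close>

text \<open>A predicate is r.e. if it is the limit of a computable stage function \<open>D\<close>. Asking for
  \<open>D t e \<noteq> 0\<close> at all large \<open>t\<close> gives closure under conjunction and bounded quantification
  without pairing of stages.\<close>

definition re :: "nat \<Rightarrow> ((nat \<Rightarrow> nat) \<Rightarrow> bool) \<Rightarrow> bool" where
  "re n P \<longleftrightarrow> (\<exists>D. computable (Suc n) (\<lambda>e. D (e 0) (\<lambda>i. e (Suc i))) \<and>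
     (\<forall>e. (P e \<longrightarrow> (\<forall>\<^sub>F t in sequentially. D t e \<noteq> 0)) \<and> (\<forall>t. D t e \<noteq> 0 \<longrightarrow> P e)))"

lemma reI:
  assumes "computable (Suc n) (\<lambda>e. D (e 0) (\<lambda>i. e (Suc i)))"
    and "\<And>e. P e \<Longrightarrow> \<forall>\<^sub>F t in sequentially. D t e \<noteq> 0"
    and "\<And>e t. D t e \<noteq> 0 \<Longrightarrow> P e"
  shows "re n P"
  using assms unfolding re_def by blast

lemma reE:
  assumes "re n P"
  obtains D where "computable (Suc n) (\<lambda>e. D (e 0) (\<lambda>i. e (Suc i)))"
    and "\<And>e. P e \<Longrightarrow> \<forall>\<^sub>F t in sequentially. D t e \<noteq> 0"
    and "\<And>e t. D t e \<noteq> 0 \<Longrightarrow> P e"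
  using assms unfolding re_def by blast

lemma computable_shift:
  assumes "computable n F" shows "computable (Suc n) (\<lambda>e. F (\<lambda>i. e (Suc i)))"
  by (rule computable_subst[OF assms]) (simp add: computable_var)

text \<open>A decidable predicate has a stage function that ignores the stage. The comparisons below
  are brought to this form by truncated subtraction.\<close>

lemma re_zero:
  assumes "computable n F" shows "re n (\<lambda>e. F e = 0)"
  by (rule reI[where D="\<lambda>t e. 1 - F e"])
    (use assms in \<open>auto intro!: computable_diff computable_const computable_shift\<close>)

lemma re_eq:
  assumes "computable n F" "computable n G" shows "re n (\<lambda>e. F e = G e)"
proof -
  have "re n (\<lambda>e. (F e - G e) + (G e - F e) = 0)"
    by (intro re_zero computable_intros assms)
  moreover have "(F e - G e) + (G e - F e) = 0 \<longleftrightarrow> F e = G e" for e by auto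
  ultimately show ?thesis by simp
qed

lemma re_less:
  assumes "computable n F" "computable n G" shows "re n (\<lambda>e. F e < G e)"
proof -
  have "re n (\<lambda>e. Suc (F e) - G e = 0)"
    by (intro re_zero computable_intros assms)
  then show ?thesis by (simp add: Suc_le_eq)
qed

lemma re_neq:
  assumes "computable n F" "computable n G" shows "re n (\<lambda>e. F e \<noteq> G e)"
proof -
  have "re n (\<lambda>e. 1 - ((F e - G e) + (G e - F e)) = 0)"
    by (intro re_zero computable_intros assms)
  moreover have "1 - ((F e - G e) + (G e - F e)) = 0 \<longleftrightarrow> F e \<noteq> G e" for e by auto
  ultimately show ?thesis by simp
qed

lemma re_conj:
  assumes "re n P" "re n Q" shows "re n (\<lambda>e. P e \<and> Q e)"
proof -
  obtain C where C: "computable (Suc n) (\<lambda>e. C (e 0) (\<lambda>i. e (Suc i)))"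
    "\<And>e. P e \<Longrightarrow> \<forall>\<^sub>F t in sequentially. C t e \<noteq> 0" "\<And>e t. C t e \<noteq> 0 \<Longrightarrow> P e"
    using reE[OF assms(1)] by blast
  obtain D where D: "computable (Suc n) (\<lambda>e. D (e 0) (\<lambda>i. e (Suc i)))"
    "\<And>e. Q e \<Longrightarrow> \<forall>\<^sub>F t in sequentially. D t e \<noteq> 0" "\<And>e t. D t e \<noteq> 0 \<Longrightarrow> Q e"
    using reE[OF assms(2)] by blast
  show ?thesis
  proof (rule reI[where D="\<lambda>t e. C t e * D t e"])
    show "computable (Suc n) (\<lambda>e. C (e 0) (\<lambda>i. e (Suc i)) * D (e 0) (\<lambda>i. e (Suc i)))"
      by (intro computable_mult C(1) D(1))
    show "\<forall>\<^sub>F t in sequentially. C t e * D t e \<noteq> 0" if "P e \<and> Q e" for e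
      using C(2)[of e] D(2)[of e] that by (auto intro: eventually_conj)
    show "P e \<and> Q e" if "C t e * D t e \<noteq> 0" for e t
      using C(3)[of t e] D(3)[of t e] that by auto
  qed
qed

lemma re_disj:
  assumes "re n P" "re n Q" shows "re n (\<lambda>e. P e \<or> Q e)"
proof -
  obtain C where C: "computable (Suc n) (\<lambda>e. C (e 0) (\<lambda>i. e (Suc i)))"
    "\<And>e. P e \<Longrightarrow> \<forall>\<^sub>F t in sequentially. C t e \<noteq> 0" "\<And>e t. C t e \<noteq> 0 \<Longrightarrow> P e"
    using reE[OF assms(1)] by blast
  obtain D where D: "computable (Suc n) (\<lambda>e. D (e 0) (\<lambda>i. e (Suc i)))"
    "\<And>e. Q e \<Longrightarrow> \<forall>\<^sub>F t in sequentially. D t e \<noteq> 0" "\<And>e t. D t e \<noteq> 0 \<Longrightarrow> Q e"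
    using reE[OF assms(2)] by blast
  show ?thesis
  proof (rule reI[where D="\<lambda>t e. C t e + D t e"])
    show "computable (Suc n) (\<lambda>e. C (e 0) (\<lambda>i. e (Suc i)) + D (e 0) (\<lambda>i. e (Suc i)))"
      by (intro computable_add C(1) D(1))
    show "\<forall>\<^sub>F t in sequentially. C t e + D t e \<noteq> 0" if "P e \<or> Q e" for e
      using C(2)[of e] D(2)[of e] that by (auto elim: eventually_mono)
    show "P e \<or> Q e" if "C t e + D t e \<noteq> 0" for e t
      using C(3)[of t e] D(3)[of t e] that by auto
  qed
qed

text \<open>Prepares a stage function for a recursion over its bound variable: the bound variable
  becomes the counter \<open>e 0\<close>, the accumulator \<open>e 1\<close> is dropped, and the
  stage is found at \<open>e 2\<close>.\<close>

lemma computable_under_binder: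
  assumes "computable (Suc (Suc n)) (\<lambda>e. D (e 0) (\<lambda>i. e (Suc i)))"
  shows "computable (Suc (Suc (Suc n))) (\<lambda>e. D (e 2) (case_nat (e 0) (\<lambda>i. e (Suc (Suc (Suc i))))))"
proof -
  define S :: "nat \<Rightarrow> (nat \<Rightarrow> nat) \<Rightarrow> nat" where "S i = (if i = 0 then (\<lambda>e. e 2) else if i = 1 then (\<lambda>e. e 0)
      else (\<lambda>e. e (Suc i)))" for i
  have "computable (Suc (Suc (Suc n))) (\<lambda>e. D (S 0 e) (\<lambda>i. S (Suc i) e))"
    by (rule computable_subst[OF assms, where S=S]) (auto simp: S_def intro!: computable_var)
  moreover have "(\<lambda>i. S (Suc i) e) = case_nat (e 0) (\<lambda>i. e (Suc (Suc (Suc i))))" for e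
    by (auto simp: S_def split: nat.splits)
  ultimately show ?thesis by (simp add: S_def)
qed

text \<open>Dovetailing: stage \<open>t\<close> tests every candidate \<open>k < t\<close> at that
  same stage \<open>t\<close>. A true witness passes at all large stages, and these eventually
  exceed it.\<close>

lemma re_ex:
  assumes "re (Suc n) (\<lambda>e. P (e 0) (\<lambda>i. e (Suc i)))"
  shows "re n (\<lambda>e. \<exists>k. P k e)"
proof -
  obtain D where D: "computable (Suc (Suc n)) (\<lambda>e. D (e 0) (\<lambda>i. e (Suc i)))"
    "\<And>e. P (e 0) (\<lambda>i. e (Suc i)) \<Longrightarrow> \<forall>\<^sub>F t in sequentially. D t e \<noteq> 0"
    "\<And>e t. D t e \<noteq> 0 \<Longrightarrow> P (e 0) (\<lambda>i. e (Suc i))"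
    using reE[OF assms] by blast
  define C where "C t e = rec_nat 0 (\<lambda>k r. r + D t (case_nat k e)) t" for t e
  have C: "C t e \<noteq> 0 \<longleftrightarrow> (\<exists>k<t. D t (case_nat k e) \<noteq> 0)" for t e
  proof -
    have "rec_nat 0 (\<lambda>k r. r + D t (case_nat k e)) m \<noteq> 0 \<longleftrightarrow> (\<exists>k<m. D t (case_nat k e) \<noteq> 0)" for m
      by (induction m) (auto simp: less_Suc_eq)
    then show ?thesis unfolding C_def .
  qed
  show ?thesis
  proof (rule reI[where D=C])
    show "computable (Suc n) (\<lambda>e. C (e 0) (\<lambda>i. e (Suc i)))"
      unfolding C_def
      by (rule computable_rec[where h="\<lambda>k r e. r + D (e 0) (case_nat k (\<lambda>i. e (Suc i)))"])
        (use computable_under_binder[OF D(1)] in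
          \<open>auto simp: numeral_2_eq_2 intro!: computable_add computable_var computable_const\<close>)
    show "\<forall>\<^sub>F t in sequentially. C t e \<noteq> 0" if "\<exists>k. P k e" for e
    proof -
      from that obtain k where "P k e" by blast
      with D(2)[of "case_nat k e"] have "\<forall>\<^sub>F t in sequentially. D t (case_nat k e) \<noteq> 0" by simp
      with eventually_gt_at_top[of k] show ?thesis
        by eventually_elim (use C in blast)
    qed
    show "\<exists>k. P k e" if C0: "C t e \<noteq> 0" for e t
    proof -
      obtain k where "D t (case_nat k e) \<noteq> 0" using C0 unfolding C by blast
      from D(3)[OF this] show ?thesis by auto
    qed
  qed
qed

text \<open>The stage functions are multiplied over all \<open>k < N e\<close>; finitely many
  eventual properties hold together eventually.\<close>

lemma re_ball:
  assumes "re (Suc n) (\<lambda>e. P (e 0) (\<lambda>i. e (Suc i)))" and N: "computable n N"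
  shows "re n (\<lambda>e. \<forall>k<N e. P k e)"
proof -
  obtain D where D: "computable (Suc (Suc n)) (\<lambda>e. D (e 0) (\<lambda>i. e (Suc i)))"
    "\<And>e. P (e 0) (\<lambda>i. e (Suc i)) \<Longrightarrow> \<forall>\<^sub>F t in sequentially. D t e \<noteq> 0"
    "\<And>e t. D t e \<noteq> 0 \<Longrightarrow> P (e 0) (\<lambda>i. e (Suc i))"
    using reE[OF assms(1)] by blast
  define C where "C t e = rec_nat 1 (\<lambda>k r. r * D t (case_nat k e)) (N e)" for t e
  have C: "C t e \<noteq> 0 \<longleftrightarrow> (\<forall>k\<in>{..<N e}. D t (case_nat k e) \<noteq> 0)" for t e
  proof -
    have "rec_nat 1 (\<lambda>k r. r * D t (case_nat k e)) m \<noteq> 0 \<longleftrightarrow> (\<forall>k<m. D t (case_nat k e) \<noteq> 0)" for m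
      by (induction m) (auto simp: less_Suc_eq)
    then show ?thesis unfolding C_def by blast
  qed
  show ?thesis
  proof (rule reI[where D=C])
    show "computable (Suc n) (\<lambda>e. C (e 0) (\<lambda>i. e (Suc i)))"
      unfolding C_def
      by (rule computable_rec[where h="\<lambda>k r e. r * D (e 0) (case_nat k (\<lambda>i. e (Suc i)))"])
        (use computable_under_binder[OF D(1)] in
          \<open>auto simp: numeral_2_eq_2 intro!: computable_mult computable_var computable_const computable_shift N\<close>)
    show "\<forall>\<^sub>F t in sequentially. C t e \<noteq> 0" if "\<forall>k<N e. P k e" for e
      unfolding C
      by (intro eventually_ball_finite ballI) (use that D(2)[of "case_nat k e" for k] in auto)
    show "\<forall>k<N e. P k e" if C0: "C t e \<noteq> 0" for e t
    proof (intro allI impI)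
      fix k assume "k < N e"
      then have "D t (case_nat k e) \<noteq> 0" using C0 unfolding C by blast
      from D(3)[OF this] show "P k e" by simp
    qed
  qed
qed

text \<open>The bounded evaluator of a program for \<open>W\<close> is a stage function:
  \<open>bev_complete\<close> gives the limit and \<open>bev_sound\<close> the correctness of
  positive answers.\<close>

lemma re_ce:
  assumes "ce W" "computable n F" shows "re n (\<lambda>e. F e \<in> W)"
proof -
  obtain f where W: "W = {x. \<exists>y. eval f [x] y}" using assms(1) unfolding ce_def by blast
  show ?thesis
  proof (rule reI[where D="\<lambda>t e. bev f t [F e]"])
    have "computable 2 (\<lambda>e. bev f (e 0) [e (Suc 0)])"
      using computable_bev[of 1 f] by (simp add: numeral_2_eq_2)
    then show "computable (Suc n) (\<lambda>e. bev f (e 0) [F (\<lambda>i. e (Suc i))])"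
      by (rule computable_app2) (auto intro: computable_var computable_shift assms(2))
    show "\<forall>\<^sub>F t in sequentially. bev f t [F e] \<noteq> 0" if "F e \<in> W" for e
      using that by (auto simp: W dest!: bev_complete elim: eventually_mono)
    show "F e \<in> W" if "bev f t [F e] \<noteq> 0" for e t
      using that bev_sound[of f t "[F e]"] by (cases "bev f t [F e]") (auto simp: W)
  qed
qed

text \<open>The program for \<open>S\<close> uses \<open>Mn\<close> to look for a stage at which
  \<open>D\<close> is non-zero; \<open>1 - D\<close> turns this into a search for a zero.\<close>

lemma ceI:
  assumes "re 1 (\<lambda>e. e 0 \<in> S)" shows "ce S"
proof -
  obtain D where D: "computable (Suc 1) (\<lambda>e. D (e 0) (\<lambda>i. e (Suc i)))"
    "\<And>e. e 0 \<in> S \<Longrightarrow> \<forall>\<^sub>F t in sequentially. D t e \<noteq> 0"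
    "\<And>e t. D t e \<noteq> 0 \<Longrightarrow> e 0 \<in> S"
    using reE[OF assms] by blast
  have "computable (Suc 1) (\<lambda>e. 1 - D (e 0) (\<lambda>i. e (Suc i)))"
    by (intro computable_diff computable_const D(1))
  then obtain g where g: "\<And>e. eval g [e 0, e 1] (1 - D (e 0) (\<lambda>i. e (Suc i)))"
    unfolding computable_def by auto
  \<comment> \<open>The program reads only positions 0 and 1; filling the remaining positions with
    \<open>x\<close> makes the environment depend on \<open>x\<close> alone.\<close>
  have g: "eval g [t, x] (1 - D t (\<lambda>_. x))" for t x
    using g[of "case_nat t (\<lambda>_. x)"] by simp
  have "x \<in> S \<longleftrightarrow> (\<exists>y. eval (Mn g) [x] y)" for x
  proof
    assume "x \<in> S"
    then have "\<exists>t. D t (\<lambda>_. x) \<noteq> 0"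
      using D(2)[of "\<lambda>_. x"] by (auto simp: eventually_sequentially)
    then obtain t where t: "D t (\<lambda>_. x) \<noteq> 0" "\<forall>m<t. D m (\<lambda>_. x) = 0"
      using exists_least_iff[of "\<lambda>t. D t (\<lambda>_. x) \<noteq> 0"] by auto
    have "eval (Mn g) [x] t"
    proof (rule eval_Mn)
      show "eval g [t, x] 0" using g[of t x] t(1) by (simp add: Suc_leI)
      show "\<forall>m<t. \<exists>k. eval g [m, x] (Suc k)"
      proof (intro allI impI)
        fix m assume "m < t"
        then show "\<exists>k. eval g [m, x] (Suc k)" using g[of m x] t(2) by auto
      qed
    qed
    then show "\<exists>y. eval (Mn g) [x] y" by blast
  next
    assume "\<exists>y. eval (Mn g) [x] y"
    then obtain t where "eval g [t, x] 0" by (auto elim: eval.cases)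
    with g[of t x] have "1 - D t (\<lambda>_. x) = 0" by (rule eval_deterministic)
    then show "x \<in> S" using D(3)[of t "\<lambda>_. x"] by simp
  qed
  then show ?thesis unfolding ce_def by blast
qed

lemmas re_intros = re_conj re_disj re_ex re_ball re_eq re_neq re_less

lemma re_subst:
  assumes "re m P" and S: "\<And>i. i < m \<Longrightarrow> computable n (S i)"
  shows "re n (\<lambda>e. P (\<lambda>i. S i e))"
proof -
  obtain D where D: "computable (Suc m) (\<lambda>e. D (e 0) (\<lambda>i. e (Suc i)))"
    "\<And>e. P e \<Longrightarrow> \<forall>\<^sub>F t in sequentially. D t e \<noteq> 0" "\<And>e t. D t e \<noteq> 0 \<Longrightarrow> P e"
    using reE[OF assms(1)] by blast
  define T where "T i = (case i of 0 \<Rightarrow> (\<lambda>e. e 0) | Suc j \<Rightarrow> (\<lambda>e. S j (\<lambda>i. e (Suc i))))" for i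
  have "computable (Suc n) (\<lambda>e. D (T 0 e) (\<lambda>i. T (Suc i) e))"
    by (rule computable_subst[OF D(1), where S=T])
      (auto simp: T_def split: nat.splits intro!: computable_var computable_shift S)
  then show ?thesis
    by (intro reI[where D="\<lambda>t e. D t (\<lambda>i. S i e)"]) (use D(2,3) in \<open>auto simp: T_def\<close>)
qed

lemma re_app1:
  assumes "re 1 (\<lambda>e. P (e 0))" "computable n F"
  shows "re n (\<lambda>e. P (F e))"
  using re_subst[OF assms(1), of n "\<lambda>_. F"] assms(2) by simp

lemma re_app2:
  assumes "re 2 (\<lambda>e. P (e 0) (e (Suc 0)))" "computable n F" "computable n G"
  shows "re n (\<lambda>e. P (F e) (G e))"
  using re_subst[OF assms(1), of n "\<lambda>i. if i = 0 then F else G"] assms(2,3) by simp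

lemma re_app3:
  assumes "re 3 (\<lambda>e. P (e 0) (e (Suc 0)) (e (Suc (Suc 0))))" "computable n F" "computable n G" "computable n H"
  shows "re n (\<lambda>e. P (F e) (G e) (H e))"
  using re_subst[OF assms(1), of n "\<lambda>i. if i = 0 then F else if i = 1 then G else H"] assms(2-4) by simp

subsection \<open>Primes and finite sets\<close>

text \<open>As \<open>re\<close> is not closed under negation, primality and its complement each get
  a form of their own: an existential one here, a bounded universal one in
  \<open>re_prime\<close>.\<close>

lemma not_prime_nat_iff: "\<not> prime m \<longleftrightarrow> m < 2 \<or> (\<exists>a b. m = a * b \<and> 1 < a \<and> 1 < b)" for m :: nat
proof
  assume "\<not> prime m"
  show "m < 2 \<or> (\<exists>a b. m = a * b \<and> 1 < a \<and> 1 < b)"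
  proof (cases "m < 2")
    case False
    then obtain a where a: "a dvd m" "a \<noteq> 1" "a \<noteq> m"
      using \<open>\<not> prime m\<close> by (auto simp: prime_nat_iff)
    then obtain b where "m = a * b" by blast
    then show ?thesis 
      using a False by (intro disjI2 exI[of _ a] exI[of _ b]) (cases a; cases b; auto)
  qed simp
next
  assume "m < 2 \<or> (\<exists>a b. m = a * b \<and> 1 < a \<and> 1 < b)"
  then show "\<not> prime m" by (auto dest: prime_product prime_ge_2_nat)
qed

lemma re_not_prime:
  assumes "computable n F" shows "re n (\<lambda>e. \<not> prime (F e))"
proof (rule re_app1[OF _ assms])
  show "re 1 (\<lambda>e. \<not> prime (e 0))"
    unfolding not_prime_nat_iff by (intro re_intros computable_intros) simp_all
qed

lemma re_prime:
  assumes "computable n F" shows "re n (\<lambda>e. prime (F e))"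
proof (rule re_app1[OF _ assms])
  have "re 1 (\<lambda>e. 1 < e 0 \<and> (\<forall>a<e 0. \<forall>b<e 0. e 0 \<noteq> a * b))"
    by (intro re_intros computable_intros) simp_all
  moreover have "1 < p \<and> (\<forall>a<p. \<forall>b<p. p \<noteq> a * b) \<longleftrightarrow> prime p" for p :: nat
  proof
    assume L: "1 < p \<and> (\<forall>a<p. \<forall>b<p. p \<noteq> a * b)"
    show "prime p"
    proof (rule ccontr)
      assume "\<not> prime p"
      then obtain a b where "p = a * b" "1 < a" "1 < b"
        using L unfolding not_prime_nat_iff by auto
      moreover from this have "a < p" "b < p" by simp_all
      ultimately show False using L by blast
    qed
  next
    assume p: "prime p"
    have "p \<noteq> a * b" if "a < p" "b < p" for a b
    proof
      assume "p = a * b"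
      then have "a = 1 \<or> b = 1" using p prime_product by blast
      then show False using that \<open>p = a * b\<close> by auto
    qed
    then show "1 < p \<and> (\<forall>a<p. \<forall>b<p. p \<noteq> a * b)" using prime_gt_1_nat[OF p] by blast
  qed
  ultimately show "re 1 (\<lambda>e. prime (e 0))" by (simp only:)
qed

text \<open>Division is eliminated by naming quotient and remainder. Odd and even bits are treated
  separately so that membership and non-membership in a coded set both become r.e.\<close>

lemma bit_iff:
  "odd (s div 2 ^ k) \<longleftrightarrow> (\<exists>q r. r < 2 ^ k \<and> s = (2 * q + 1) * 2 ^ k + r)"
  "even (s div 2 ^ k) \<longleftrightarrow> (\<exists>q r. r < 2 ^ k \<and> s = 2 * q * 2 ^ k + r)" for s k :: nat
proof -
  have div: "(a * 2 ^ k + r) div 2 ^ k = a" if "r < 2 ^ k" for a r :: nat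
    using that by (simp add: div_mult_self3)
  have s: "s = s div 2 ^ k * 2 ^ k + s mod 2 ^ k" by (rule div_mult_mod_eq[symmetric])
  show "odd (s div 2 ^ k) \<longleftrightarrow> (\<exists>q r. r < 2 ^ k \<and> s = (2 * q + 1) * 2 ^ k + r)"
  proof
    assume "odd (s div 2 ^ k)"
    then obtain q where "s div 2 ^ k = 2 * q + 1" by (auto elim: oddE)
    then show "\<exists>q r. r < 2 ^ k \<and> s = (2 * q + 1) * 2 ^ k + r"
      using s by (intro exI[of _ q] exI[of _ "s mod 2 ^ k"]) auto
  next
    assume "\<exists>q r. r < 2 ^ k \<and> s = (2 * q + 1) * 2 ^ k + r"
    then show "odd (s div 2 ^ k)" using div by (elim exE conjE) (simp only:, simp)
  qed
  show "even (s div 2 ^ k) \<longleftrightarrow> (\<exists>q r. r < 2 ^ k \<and> s = 2 * q * 2 ^ k + r)"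
  proof
    assume "even (s div 2 ^ k)"
    then obtain q where "s div 2 ^ k = 2 * q" by (auto elim: evenE)
    then show "\<exists>q r. r < 2 ^ k \<and> s = 2 * q * 2 ^ k + r"
      using s by (intro exI[of _ q] exI[of _ "s mod 2 ^ k"]) auto
  next
    assume "\<exists>q r. r < 2 ^ k \<and> s = 2 * q * 2 ^ k + r"
    then show "even (s div 2 ^ k)" using div by (elim exE conjE) (simp only:, simp)
  qed
qed

lemma re_mem_set_decode:
  assumes "computable n F" "computable n G" shows "re n (\<lambda>e. F e \<in> set_decode (G e))"
proof (rule re_app2[OF _ assms])
  show "re 2 (\<lambda>e. e 0 \<in> set_decode (e (Suc 0)))"
    unfolding set_decode_def mem_Collect_eq bit_iff(1)
    by (intro re_intros computable_intros) simp_all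
qed

lemma re_not_mem_set_decode:
  assumes "computable n F" "computable n G" shows "re n (\<lambda>e. F e \<notin> set_decode (G e))"
proof (rule re_app2[OF _ assms])
  show "re 2 (\<lambda>e. e 0 \<notin> set_decode (e (Suc 0)))"
    unfolding set_decode_def mem_Collect_eq not_not bit_iff(2)
    by (intro re_intros computable_intros) simp_all
qed

lemma mem_set_decode_less: "k \<in> set_decode s \<Longrightarrow> k < s"
proof -
  assume "k \<in> set_decode s"
  then have "s div 2 ^ k \<noteq> 0" by (auto simp: set_decode_def intro: ccontr)
  then have "2 ^ k \<le> s" by (simp add: div_eq_0_iff)
  then show "k < s" using less_exp[of k] by linarith
qed

text \<open>Members of a coded set lie below its code, which bounds the quantifier; the implication
  is written as a disjunction to fit \<open>re_disj\<close>.\<close>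

lemma set_decode_subset_iff: "set_decode s \<subseteq> S \<longleftrightarrow> (\<forall>k<s. k \<notin> set_decode s \<or> k \<in> S)"
  using mem_set_decode_less by blast

primrec nth_prime :: "nat \<Rightarrow> nat" where
  "nth_prime 0 = 2"
| "nth_prime (Suc n) = (LEAST p. prime p \<and> nth_prime n < p)"

lemma nth_prime_Suc: "prime (nth_prime (Suc n)) \<and> nth_prime n < nth_prime (Suc n)"
proof -
  have "\<exists>p. prime p \<and> nth_prime n < p" using bigger_prime by blast
  from LeastI_ex[OF this] show ?thesis by simp
qed

lemma prime_nth_prime: "prime (nth_prime n)"
  using nth_prime_Suc by (cases n) auto

lemma inj_nth_prime: "inj nth_prime"
  by (rule strict_mono_imp_inj_on) (use nth_prime_Suc in \<open>auto simp: strict_mono_Suc_iff\<close>)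

text \<open>The relation between a prime and its successor among the primes, written with
  \<open><\<close> and disjunction to match the closure properties.\<close>

definition next_prime :: "nat \<Rightarrow> nat \<Rightarrow> bool" where
  "next_prime x y \<longleftrightarrow> prime y \<and> x < y \<and> (\<forall>m<y. m < Suc x \<or> \<not> prime m)"

lemma next_prime_iff: "next_prime (nth_prime n) y \<longleftrightarrow> y = nth_prime (Suc n)"
proof
  assume "next_prime (nth_prime n) y"
  then show "y = nth_prime (Suc n)"
    unfolding next_prime_def nth_prime.simps
    by (intro Least_equality[symmetric]) (auto simp: not_less[symmetric])
next
  assume "y = nth_prime (Suc n)"
  then show "next_prime (nth_prime n) y"
    using nth_prime_Suc[of n] not_less_Least[of _ "\<lambda>p. prime p \<and> nth_prime n < p"]
    unfolding next_prime_def by (auto simp: not_less less_Suc_eq_le)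
qed

text \<open>The recursion is replaced by the existence of a code \<open>u\<close> of its course of
  values, here the list of the first \<open>n + 1\<close> primes.\<close>

lemma nth_prime_graph:
  "p = nth_prime n \<longleftrightarrow> (\<exists>u. nth_code u 0 = 2 \<and>
     (\<forall>k<n. next_prime (nth_code u k) (nth_code u (Suc k))) \<and> p = nth_code u n)"
proof
  assume p: "p = nth_prime n"
  define u where "u = list_encode (map nth_prime [0..<Suc n])"
  have "nth_code u k = nth_prime k" if "k \<le> n" for k
    using that unfolding u_def by (subst nth_code_list_encode) (auto simp del: upt_Suc)
  then show "\<exists>u. nth_code u 0 = 2 \<and>
     (\<forall>k<n. next_prime (nth_code u k) (nth_code u (Suc k))) \<and> p = nth_code u n"
    using p by (intro exI[of _ u]) (simp add: next_prime_iff del: nth_prime.simps(2))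
next
  assume "\<exists>u. nth_code u 0 = 2 \<and>
     (\<forall>k<n. next_prime (nth_code u k) (nth_code u (Suc k))) \<and> p = nth_code u n"
  then obtain u where u: "nth_code u 0 = 2" "p = nth_code u n"
    "\<And>k. k < n \<Longrightarrow> next_prime (nth_code u k) (nth_code u (Suc k))" by blast
  have "k \<le> n \<Longrightarrow> nth_code u k = nth_prime k" for k
  proof (induction k)
    case (Suc k)
    then show ?case using u(3)[of k] next_prime_iff[of k] by simp
  qed (simp add: u)
  then show "p = nth_prime n" using u by simp
qed

lemma re_nth_prime:
  assumes "computable n F" "computable n G" shows "re n (\<lambda>e. F e = nth_prime (G e))"
proof (rule re_app2[OF _ assms])
  show "re 2 (\<lambda>e. e 0 = nth_prime (e (Suc 0)))"
    unfolding nth_prime_graph next_prime_def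
    by (intro re_intros re_prime re_not_prime computable_nth_code computable_intros) simp_all
qed

section \<open>Structures\<close>

subsection \<open>Codes of literals and the diagrams of prime fields\<close>

lemma inj_atom_code: "inj atom_code"
proof (rule injI)
  fix x y assume "atom_code x = atom_code y"
  then show "x = y"
    by (cases x; cases y) (auto simp: list_encode_eq dest: arg_cong[where f=even])
qed

lemma inj_lit_code: "inj lit_code"
proof (rule injI)
  fix x y :: lit assume "lit_code x = lit_code y"
  then show "x = y"
    by (cases x; cases y) (auto simp: inj_eq[OF inj_atom_code] split: if_splits)
qed

lemma set_decode_litset_code: "finite \<alpha> \<Longrightarrow> set_decode (litset_code \<alpha>) = lit_code ` \<alpha>"
  by (simp add: litset_code_def)

lemma is_atom_L_PF_iff:
  "is_atom L_PF U a \<longleftrightarrow> (\<exists>x\<in>U. \<exists>y\<in>U. a = AEq x y) \<or>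
     (\<exists>x\<in>U. \<exists>y\<in>U. \<exists>z\<in>U. a = ARel 0 [x, y, z] \<or> a = ARel 1 [x, y, z]) \<or>
     (\<exists>x\<in>U. a = ARel 2 [x] \<or> a = ARel 3 [x])"
proof (cases a)
  case (ARel i xs)
  have len: "length xs = 3 \<longleftrightarrow> (\<exists>x y z. xs = [x, y, z])" "length xs = 1 \<longleftrightarrow> (\<exists>x. xs = [x])"
    by (auto simp: numeral_3_eq_3 length_Suc_conv)
  have "i < length L_PF \<longleftrightarrow> i = 0 \<or> i = 1 \<or> i = 2 \<or> i = 3"
    by (auto simp: L_PF_def)
  then show ?thesis
    using len by (auto simp: ARel L_PF_def)
qed auto

text \<open>Trades the quantifier over atoms for quantifiers over numbers, to which the closure
  properties apply.\<close>

lemma ex_atom_L_PF_iff: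
  "(\<exists>a. is_atom L_PF U a \<and> Q a) \<longleftrightarrow> (\<exists>x\<in>U. \<exists>y\<in>U. Q (AEq x y)) \<or>
     (\<exists>x\<in>U. \<exists>y\<in>U. \<exists>z\<in>U. Q (ARel 0 [x, y, z]) \<or> Q (ARel 1 [x, y, z])) \<or>
     (\<exists>x\<in>U. Q (ARel 2 [x]) \<or> Q (ARel 3 [x]))"
  (is "?L \<longleftrightarrow> ?E \<or> ?T \<or> ?U")
proof
  assume ?L
  then obtain a where "is_atom L_PF U a" and Q: "Q a" by blast
  then consider x y where "x \<in> U" "y \<in> U" "a = AEq x y"
    | x y z where "x \<in> U" "y \<in> U" "z \<in> U" "a = ARel 0 [x, y, z] \<or> a = ARel 1 [x, y, z]"
    | x where "x \<in> U" "a = ARel 2 [x] \<or> a = ARel 3 [x]"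
    unfolding is_atom_L_PF_iff by (elim disjE bexE) simp_all
  then show "?E \<or> ?T \<or> ?U"
  proof cases
    case 1
    then have ?E using Q by blast
    then show ?thesis ..
  next
    case 2
    then have ?T using Q by blast
    then show ?thesis by simp
  next
    case 3
    then have ?U using Q by blast
    then show ?thesis by simp
  qed
next
  have at: "is_atom L_PF U (AEq x y)" "is_atom L_PF U (ARel 0 [x, y, z])" "is_atom L_PF U (ARel 1 [x, y, z])"
    "is_atom L_PF U (ARel 2 [x])" "is_atom L_PF U (ARel 3 [x])" if "x \<in> U" "y \<in> U" "z \<in> U" for x y z
    using that by (simp_all add: L_PF_def)
  \<comment> \<open>The conjunct with \<open>Q\<close> is discharged first, because it determines
    the atom.\<close>
  assume "?E \<or> ?T \<or> ?U"
  then show ?L by - (elim disjE bexE; (rule exI, rule conjI[rotated], assumption, (rule at; assumption)))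
qed

lemma mem_lit_code_diag_iff:
  "k \<in> lit_code ` diag L A \<longleftrightarrow> (\<exists>a. is_atom L (univ A) a \<and> k = lit_code (holds A a, a))"
  unfolding diag_def by blast

text \<open>Replaces the conditional in a literal code by a quantified truth value \<open>v\<close>,
  leaving only conjunction, disjunction and equations.\<close>

lemma truth_value_graph:
  "(\<exists>v. (v = 1 \<and> Q \<or> v = 0 \<and> \<not> Q) \<and> k = prod_encode (v, x)) \<longleftrightarrow>
   k = prod_encode (if Q then 1 else 0, x)"
  by auto

text \<open>Here \<open>d\<close> is the remainder and \<open>m\<close> the quotient of
  \<open>w\<close> by \<open>p\<close>, so that \<open>mod\<close> is expressed through addition and
  multiplication.\<close>

lemma mod_truth_value_graph:
  fixes p w c :: nat
  assumes "p > 0"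
  shows "(\<exists>d m. d < p \<and> w = d + m * p \<and>
      (\<exists>v. (v = 1 \<and> c = d \<or> v = 0 \<and> c \<noteq> d) \<and> k = prod_encode (v, x))) \<longleftrightarrow>
    k = prod_encode (if c = w mod p then 1 else 0, x)"
proof -
  have eq: "(\<exists>m. w = d + m * p) \<longleftrightarrow> d = w mod p" if "d < p" for d
  proof
    assume "d = w mod p"
    then have "w = d + w div p * p" by (metis mod_div_mult_eq)
    then show "\<exists>m. w = d + m * p" by blast
  qed (use that in auto)
  have "(\<exists>d m. d < p \<and> w = d + m * p \<and> Q d) \<longleftrightarrow> Q (w mod p)" for Q
    using eq mod_less_divisor[OF assms, of w] by metis
  from this[of "\<lambda>d. k = prod_encode (if c = d then 1 else 0, x)"]
  show ?thesis unfolding truth_value_graph .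
qed

lemma mem_lit_code_diag_Zp_iff:
  "k \<in> lit_code ` diag L_PF (Zp p) \<longleftrightarrow>
    (\<exists>a<p. \<exists>b<p. \<exists>v. (v = 1 \<and> a = b \<or> v = 0 \<and> a \<noteq> b) \<and> k = prod_encode (v, atom_code (AEq a b))) \<or>
    (\<exists>a<p. \<exists>b<p. \<exists>c<p.
       (\<exists>d m. d < p \<and> a + b = d + m * p \<and> (\<exists>v. (v = 1 \<and> c = d \<or> v = 0 \<and> c \<noteq> d) \<and>
          k = prod_encode (v, atom_code (ARel 0 [a, b, c])))) \<or>
       (\<exists>d m. d < p \<and> a * b = d + m * p \<and> (\<exists>v. (v = 1 \<and> c = d \<or> v = 0 \<and> c \<noteq> d) \<and>
          k = prod_encode (v, atom_code (ARel 1 [a, b, c]))))) \<or>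
    (\<exists>a<p.
       (\<exists>v. (v = 1 \<and> a = 0 \<or> v = 0 \<and> a \<noteq> 0) \<and> k = prod_encode (v, atom_code (ARel 2 [a]))) \<or>
       (\<exists>v. (v = 1 \<and> a = 1 \<or> v = 0 \<and> a \<noteq> 1) \<and> k = prod_encode (v, atom_code (ARel 3 [a]))))"
\<comment> \<open>Remainders below \<open>p\<close> require \<open>p > 0\<close>; for
  \<open>p = 0\<close> the universe is empty and both sides are false.\<close>
proof (cases "p > 0")
  case True
  have univ: "univ (Zp p) = {..<p}" by (simp add: Zp_def)
  have "k \<in> lit_code ` diag L_PF (Zp p) \<longleftrightarrow>
    (\<exists>a\<in>{..<p}. \<exists>b\<in>{..<p}. k = lit_code (holds (Zp p) (AEq a b), AEq a b)) \<or>
    (\<exists>a\<in>{..<p}. \<exists>b\<in>{..<p}. \<exists>c\<in>{..<p}.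
       k = lit_code (holds (Zp p) (ARel 0 [a, b, c]), ARel 0 [a, b, c]) \<or>
       k = lit_code (holds (Zp p) (ARel 1 [a, b, c]), ARel 1 [a, b, c])) \<or>
    (\<exists>a\<in>{..<p}. k = lit_code (holds (Zp p) (ARel 2 [a]), ARel 2 [a]) \<or>
       k = lit_code (holds (Zp p) (ARel 3 [a]), ARel 3 [a]))"
    unfolding mem_lit_code_diag_iff ex_atom_L_PF_iff univ ..
  also have "\<dots> \<longleftrightarrow>
    (\<exists>a\<in>{..<p}. \<exists>b\<in>{..<p}. k = prod_encode (if a = b then 1 else 0, atom_code (AEq a b))) \<or>
    (\<exists>a\<in>{..<p}. \<exists>b\<in>{..<p}. \<exists>c\<in>{..<p}.
       k = prod_encode (if c = (a + b) mod p then 1 else 0, atom_code (ARel 0 [a, b, c])) \<or>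
       k = prod_encode (if c = (a * b) mod p then 1 else 0, atom_code (ARel 1 [a, b, c]))) \<or>
    (\<exists>a\<in>{..<p}. k = prod_encode (if a = 0 then 1 else 0, atom_code (ARel 2 [a])) \<or>
       k = prod_encode (if a = 1 then 1 else 0, atom_code (ARel 3 [a])))"
    by (intro arg_cong2[where f="(\<or>)"] bex_cong refl) (simp_all add: Zp_def)
  finally show ?thesis
    unfolding mod_truth_value_graph[OF True] unfolding truth_value_graph Bex_def lessThan_iff .
qed (simp add: mem_lit_code_diag_iff is_atom_L_PF_iff Zp_def)

lemma re_diag_Zp:
  assumes "computable n F" "computable n G"
  shows "re n (\<lambda>e. F e \<in> lit_code ` diag L_PF (Zp (G e)))"
proof (rule re_app2[OF _ assms])
  show "re 2 (\<lambda>e. e 0 \<in> lit_code ` diag L_PF (Zp (e (Suc 0))))"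
    unfolding mem_lit_code_diag_Zp_iff atom_code.simps list_encode.simps
    by (intro re_intros computable_intros) simp_all
qed

subsection \<open>Structures and isomorphism\<close>

text \<open>The universe is read off from the equations \<open>AEq x x\<close> and the relations
  from the positive literals; by \<open>is_struc\<close> a relation holds only of tuples that form
  atoms.\<close>

lemma diag_inj:
  assumes A: "is_struc L A" and B: "is_struc L B" and eq: "diag L A = diag L B"
  shows "A = B"
proof -
  have "x \<in> univ C \<longleftrightarrow> (True, AEq x x) \<in> diag L C" for x and C :: struc
    by (auto simp: diag_def)
  then have u: "univ A = univ B" using eq by blast
  have "rels C i xs \<longleftrightarrow> (True, ARel i xs) \<in> diag L C" if "is_struc L C" for C i xs
    using that by (auto simp: diag_def is_struc_def)
  then have "rels A = rels B" using A B eq by (intro ext) simp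
  then show ?thesis using u by (intro struc.equality) auto
qed

lemma iso_refl: "iso A A"
  unfolding iso_def by (rule exI[of _ id]) auto

lemma iso_sym:
  assumes "iso A B" shows "iso B A"
proof -
  obtain f where f: "bij_betw f (univ A) (univ B)"
    "\<And>i xs. set xs \<subseteq> univ A \<Longrightarrow> rels A i xs \<longleftrightarrow> rels B i (map f xs)"
    using assms unfolding iso_def by blast
  define g where "g = the_inv_into (univ A) f"
  have g: "bij_betw g (univ B) (univ A)" unfolding g_def by (rule bij_betw_the_inv_into[OF f(1)])
  have fg: "f (g y) = y" if "y \<in> univ B" for y
    using that f(1) unfolding g_def bij_betw_def by (auto intro: f_the_inv_into_f)
  have "rels B i xs \<longleftrightarrow> rels A i (map g xs)" if xs: "set xs \<subseteq> univ B" for i xs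
  proof -
    have "set (map g xs) \<subseteq> univ A" using xs g by (auto simp: bij_betw_def)
    then have "rels A i (map g xs) \<longleftrightarrow> rels B i (map f (map g xs))" by (rule f(2))
    also have "map f (map g xs) = xs" using xs fg by (auto intro!: map_idI)
    finally show ?thesis by simp
  qed
  then show ?thesis using g unfolding iso_def by blast
qed

lemma iso_trans:
  assumes "iso A B" "iso B C" shows "iso A C"
proof -
  obtain f where f: "bij_betw f (univ A) (univ B)"
    "\<And>i xs. set xs \<subseteq> univ A \<Longrightarrow> rels A i xs \<longleftrightarrow> rels B i (map f xs)"
    using assms(1) unfolding iso_def by blast
  obtain g where g: "bij_betw g (univ B) (univ C)"
    "\<And>i xs. set xs \<subseteq> univ B \<Longrightarrow> rels B i xs \<longleftrightarrow> rels C i (map g xs)"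
    using assms(2) unfolding iso_def by blast
  have "rels A i xs \<longleftrightarrow> rels C i (map (g \<circ> f) xs)" if xs: "set xs \<subseteq> univ A" for i xs
  proof -
    have "set (map f xs) \<subseteq> univ B" using xs f(1) by (auto simp: bij_betw_def)
    from g(2)[OF this] f(2)[OF xs] show ?thesis by simp
  qed
  then show ?thesis
    using bij_betw_trans[OF f(1) g(1)] unfolding iso_def by blast
qed

lemma univ_Zp [simp]: "univ (Zp p) = {..<p}"
  by (simp add: Zp_def)

lemma Zp_mem_PF:
  assumes "prime p" shows "Zp p \<in> PF"
proof -
  have "p > 1" using assms by (rule prime_gt_1_nat)
  then have "is_struc L_PF (Zp p)"
    by (auto simp: is_struc_def Zp_def L_PF_def split: if_splits)
  then show ?thesis using assms iso_refl unfolding PF_def by blast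
qed

lemma iso_Zp_imp_eq: "iso (Zp p) (Zp q) \<Longrightarrow> p = q"
  unfolding iso_def using bij_betw_same_card[of _ "{..<p}" "{..<q}"] by auto

subsection \<open>Certificates for the characteristic\<close>

text \<open>The elements \<open>c 0, \<dots>, c p\<close> are \<open>0, 1, 1 + 1, \<dots>, p \<cdot> 1 = 0\<close>. All literals are positive
  and relational, so they are satisfiable in a finite structure for any choice of \<open>c\<close>.\<close>

definition char_cert :: "(nat \<Rightarrow> nat) \<Rightarrow> nat \<Rightarrow> lit set" where
  "char_cert c p = {(True, ARel 2 [c 0]), (True, ARel 3 [c 1]), (True, ARel 2 [c p])} \<union>
     (\<lambda>i. (True, ARel 0 [c i, c 1, c (Suc i)])) ` {..<p}"

lemma finite_char_cert: "finite (char_cert c p)"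
  by (simp add: char_cert_def)

text \<open>Transported along \<open>f\<close>, the literals say that \<open>f (c 0) = 0\<close> and
  that each step adds 1 modulo \<open>q\<close>; hence \<open>f (c i) = i mod q\<close>, and the
  last literal becomes \<open>q dvd p\<close>. Since \<open>p\<close> may be 0, \<open>c 1\<close>
  is listed separately.\<close>

lemma char_cert_subset_diag_iff:
  assumes q: "q > 1" and f: "bij_betw f (univ A) {..<q}"
    "\<And>i xs. set xs \<subseteq> univ A \<Longrightarrow> rels A i xs \<longleftrightarrow> rels (Zp q) i (map f xs)"
  shows "char_cert c p \<subseteq> diag L_PF A \<longleftrightarrow>
    c ` {..p} \<subseteq> univ A \<and> c 1 \<in> univ A \<and> (\<forall>i\<le>p. f (c i) = i mod q) \<and> f (c 1) = 1 \<and> q dvd p"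
proof -
  have less: "f x < q" if "x \<in> univ A" for x
    using that f(1) by (auto simp: bij_betw_def)
  have d2: "(True, ARel 2 [x]) \<in> diag L_PF A \<longleftrightarrow> x \<in> univ A \<and> f x = 0" for x
    using f(2)[of "[x]" 2] q by (auto simp: diag_def L_PF_def Zp_def)
  have d3: "(True, ARel 3 [x]) \<in> diag L_PF A \<longleftrightarrow> x \<in> univ A \<and> f x = 1" for x
    using f(2)[of "[x]" 3] q by (auto simp: diag_def L_PF_def Zp_def)
  have d0: "(True, ARel 0 [x, y, z]) \<in> diag L_PF A \<longleftrightarrow>
      x \<in> univ A \<and> y \<in> univ A \<and> z \<in> univ A \<and> f z = (f x + f y) mod q" for x y z
    using f(2)[of "[x, y, z]" 0] less by (auto simp: diag_def L_PF_def Zp_def)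
  have "char_cert c p \<subseteq> diag L_PF A \<longleftrightarrow>
      (c 0 \<in> univ A \<and> f (c 0) = 0) \<and> (c 1 \<in> univ A \<and> f (c 1) = 1) \<and> (c p \<in> univ A \<and> f (c p) = 0) \<and>
      (\<forall>i<p. c i \<in> univ A \<and> c 1 \<in> univ A \<and> c (Suc i) \<in> univ A \<and> f (c (Suc i)) = (f (c i) + f (c 1)) mod q)"
    unfolding char_cert_def
    by (simp only: Un_subset_iff insert_subset empty_subsetI image_subset_iff Ball_def lessThan_iff
        d0 d2 d3 conj_assoc simp_thms)
  also have "\<dots> \<longleftrightarrow> c ` {..p} \<subseteq> univ A \<and> c 1 \<in> univ A \<and> (\<forall>i\<le>p. f (c i) = i mod q) \<and> f (c 1) = 1 \<and> q dvd p"
    (is "?L \<longleftrightarrow> ?R")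
  proof
    assume L: ?L
    then have L0: "c 0 \<in> univ A" "f (c 0) = 0" and L1: "f (c 1) = 1" and Lp: "f (c p) = 0"
      by blast+
    have "i \<le> p \<Longrightarrow> c i \<in> univ A \<and> f (c i) = i mod q" for i
    proof (induction i)
      case (Suc i)
      then have "i < p" by simp
      with L have "c (Suc i) \<in> univ A" "f (c (Suc i)) = (f (c i) + f (c 1)) mod q" by blast+
      moreover have "f (c i) = i mod q" using Suc.IH \<open>i < p\<close> by simp
      ultimately show ?case using L1 by (simp add: mod_Suc_eq)
    qed (use L0 in simp)
    then have "c ` {..p} \<subseteq> univ A" "\<forall>i\<le>p. f (c i) = i mod q" by blast+
    moreover from this have "q dvd p" using Lp by (simp add: dvd_eq_mod_eq_0)
    ultimately show ?R using L by blast
  next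
    assume R: ?R
    then have R1: "f (c 1) = 1" and dvd: "q dvd p" by blast+
    then have c: "c i \<in> univ A" "f (c i) = i mod q" if "i \<le> p" for i
      using that R by blast+
    have "f (c (Suc i)) = (f (c i) + f (c 1)) mod q" if "i < p" for i
      using that R1 c(2)[of i] c(2)[of "Suc i"] by (simp add: mod_Suc_eq)
    moreover have "f (c p) = 0" using dvd c(2)[of p] by (simp add: dvd_eq_mod_eq_0)
    moreover have "f (c 0) = 0" using c(2)[of 0] by simp
    moreover have "c 0 \<in> univ A" "c p \<in> univ A" "\<And>i. i < p \<Longrightarrow> c i \<in> univ A \<and> c (Suc i) \<in> univ A"
      using c(1) by simp_all
    ultimately show ?L using R by blast
  qed
  finally show ?thesis .
qed

lemma PF_E:
  assumes "A \<in> PF"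
  obtains p f where "prime p" "iso A (Zp p)" "bij_betw f (univ A) {..<p}"
    "\<And>i xs. set xs \<subseteq> univ A \<Longrightarrow> rels A i xs \<longleftrightarrow> rels (Zp p) i (map f xs)"
  using assms unfolding PF_def iso_def by auto

text \<open>The certificate forces the order of the field to divide \<open>p\<close>, and
  divisibility between primes is equality.\<close>

lemma char_cert_subset_diag_imp_eq:
  assumes A: "A \<in> PF" "iso A (Zp q)" and p: "prime p" and sub: "char_cert c p \<subseteq> diag L_PF A"
  shows "p = q"
proof -
  obtain r f where r: "prime r" "iso A (Zp r)" "bij_betw f (univ A) {..<r}"
    "\<And>i xs. set xs \<subseteq> univ A \<Longrightarrow> rels A i xs \<longleftrightarrow> rels (Zp r) i (map f xs)"
    using PF_E[OF A(1)] by blast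
  have "r = q" by (rule iso_Zp_imp_eq) (use r(2) A(2) iso_sym iso_trans in blast)
  moreover have "r dvd p"
    using sub char_cert_subset_diag_iff[OF prime_gt_1_nat[OF r(1)] r(3,4)] by blast
  ultimately show ?thesis using primes_dvd_imp_eq r(1) p by blast
qed

lemma char_cert_exists:
  assumes A: "A \<in> PF" "iso A (Zp p)"
  obtains u where "char_cert (nth_code u) p \<subseteq> diag L_PF A"
proof -
  obtain r f where r: "prime r" "iso A (Zp r)" and f: "bij_betw f (univ A) {..<r}"
    "\<And>i xs. set xs \<subseteq> univ A \<Longrightarrow> rels A i xs \<longleftrightarrow> rels (Zp r) i (map f xs)"
    using PF_E[OF A(1)] by blast
  have rp: "r = p" by (rule iso_Zp_imp_eq) (use r(2) A(2) iso_sym iso_trans in blast)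
  have p: "p > 1" using r(1) rp prime_gt_1_nat by blast
  define g where "g = the_inv_into (univ A) f"
  have g: "g y \<in> univ A" "f (g y) = y" if "y < p" for y
    using that f(1) unfolding g_def bij_betw_def rp
    by (auto intro: f_the_inv_into_f the_inv_into_into)
  \<comment> \<open>Reduction modulo \<open>p\<close> makes the entry at index \<open>p\<close>
    return to zero; the list has \<open>p + 1\<close> entries because the certificate uses this
    index.\<close>
  define u where "u = list_encode (map (\<lambda>i. g (i mod p)) [0..<Suc p])"
  have u: "nth_code u i = g (i mod p)" if "i \<le> p" for i
    using that unfolding u_def by (subst nth_code_list_encode) (auto simp del: upt_Suc)
  have "char_cert (nth_code u) p \<subseteq> diag L_PF A"
    using p u g char_cert_subset_diag_iff[OF _ f, of "nth_code u" p] unfolding rp by auto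
  then show thesis by (rule that)
qed

text \<open>The relations of \<open>B\<close> are exactly the facts asserted by the certificate, and
  no negative literal can contradict them.\<close>

lemma char_cert_in_finite_struc:
  "\<exists>B. is_struc L_PF B \<and> finite (univ B) \<and> char_cert c p \<subseteq> diag L_PF B"
proof -
  define U where "U = insert (c 1) (c ` {..p})"
  define B where "B = \<lparr>univ = U, rels = (\<lambda>i xs. (True, ARel i xs) \<in> char_cert c p)\<rparr>"
  have at: "is_atom L_PF U a" if "(b, a) \<in> char_cert c p" for a b
    using that by (auto simp: char_cert_def L_PF_def U_def)
  then have "is_struc L_PF B"
    unfolding is_struc_def B_def by (fastforce simp: U_def)
  moreover have "char_cert c p \<subseteq> diag L_PF B"
  proof
    fix l assume l: "l \<in> char_cert c p"
    then obtain i xs where "l = (True, ARel i xs)" by (auto simp: char_cert_def)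
    with l at[of True "ARel i xs"] show "l \<in> diag L_PF B" by (auto simp: diag_def B_def)
  qed
  moreover have "finite (univ B)" by (simp add: B_def U_def)
  ultimately show ?thesis by blast
qed

section \<open>R.e. form of the relation between certificates and their codes\<close>

lemma eq_set_encode_iff: "finite S \<Longrightarrow> s = set_encode S \<longleftrightarrow> set_decode s = S"
  by auto

text \<open>Instead of computing the code, both inclusions between the decoded set and the
  certificate are checked, each by bounded quantifiers.\<close>

lemma eq_litset_code_char_cert_iff:
  "s = litset_code (char_cert c p) \<longleftrightarrow>
    (\<forall>k<s. k \<notin> set_decode s \<or> k = lit_code (True, ARel 2 [c 0]) \<or> k = lit_code (True, ARel 3 [c 1]) \<or>
       k = lit_code (True, ARel 2 [c p]) \<or> (\<exists>i. i < p \<and> k = lit_code (True, ARel 0 [c i, c 1, c (Suc i)]))) \<and>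
    lit_code (True, ARel 2 [c 0]) \<in> set_decode s \<and> lit_code (True, ARel 3 [c 1]) \<in> set_decode s \<and>
    lit_code (True, ARel 2 [c p]) \<in> set_decode s \<and>
    (\<forall>i<p. lit_code (True, ARel 0 [c i, c 1, c (Suc i)]) \<in> set_decode s)"
proof -
  have "s = litset_code (char_cert c p) \<longleftrightarrow> set_decode s = lit_code ` char_cert c p"
    unfolding litset_code_def by (rule eq_set_encode_iff) (simp add: finite_char_cert)
  also have "\<dots> \<longleftrightarrow> set_decode s \<subseteq> lit_code ` char_cert c p \<and> lit_code ` char_cert c p \<subseteq> set_decode s"
    by blast
  finally show ?thesis
    unfolding set_decode_subset_iff char_cert_def
    by (simp only: image_Un image_insert image_empty image_image Un_iff insert_iff empty_iff image_iff
        Un_subset_iff insert_subset empty_subsetI image_subset_iff Bex_def Ball_def lessThan_iff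
        simp_thms conj_assoc disj_assoc)
qed

lemma re_litset_code_char_cert:
  assumes "computable n F" "computable n G" "computable n H"
  shows "re n (\<lambda>e. F e = litset_code (char_cert (nth_code (G e)) (H e)))"
proof (rule re_app3[OF _ assms])
  show "re 3 (\<lambda>e. e 0 = litset_code (char_cert (nth_code (e (Suc 0))) (e (Suc (Suc 0)))))"
    unfolding eq_litset_code_char_cert_iff lit_code.simps atom_code.simps list_encode.simps if_True
    by (intro re_intros re_mem_set_decode re_not_mem_set_decode computable_nth_code computable_intros) simp_all
qed

theorem theorem3p2:
  fixes L :: lang and K :: "struc set"
  assumes "is_class L K"
  shows "comp_reducible L_PF PF L K \<longleftrightarrow>
    (\<exists>K0. is_class L K0 \<and> K0 \<subseteq> K \<and> infinite (K0 // iso_rel K0) \<and>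
          (\<exists>E. friedberg_enumeration L K0 E))"
proof

  \<comment> \<open>From an embedding to a Friedberg enumeration\<close>
  have strucK: "is_struc L A" if "A \<in> K" for A
    using assms that unfolding is_class_def by blast
  assume "comp_reducible L_PF PF L K"
  then obtain \<Phi> where emb: "comp_embedding L_PF PF L K \<Phi>" unfolding comp_reducible_def by blast
  define W where "W = (\<lambda>(\<alpha>, \<phi>). prod_encode (litset_code \<alpha>, lit_code \<phi>)) ` \<Phi>"
  have trans: "comp_transformation L_PF PF L K \<Phi>"
    using emb unfolding comp_embedding_def by blast
  then have W: "ce W" and fin: "\<And>\<alpha> \<phi>. (\<alpha>, \<phi>) \<in> \<Phi> \<Longrightarrow> finite \<alpha>"
    and img: "\<And>A. A \<in> PF \<Longrightarrow> \<exists>B\<in>K. image_diag L_PF \<Phi> A = diag L B"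
    unfolding comp_transformation_def W_def by auto
  \<comment> \<open>Indices of an enumeration run through all numbers, so the primes are renumbered
    in increasing order.\<close>
  define Z where "Z n = Zp (nth_prime n)" for n
  have Z: "Z n \<in> PF" for n unfolding Z_def by (rule Zp_mem_PF[OF prime_nth_prime])
  obtain B where B: "\<And>n. B n \<in> K" "\<And>n. image_diag L_PF \<Phi> (Z n) = diag L (B n)"
    using img[OF Z] by metis
  have iso_B: "m = n" if "iso (B m) (B n)" for m n
  proof -
    have "iso (Z m) (Z n)" using emb B Z that unfolding comp_embedding_def by blast
    then show ?thesis unfolding Z_def using iso_Zp_imp_eq inj_nth_prime by (auto dest: injD)
  qed
  define K0 where "K0 = {A. is_struc L A \<and> (\<exists>n. iso (B n) A)}"
  have BK0: "B n \<in> K0" for n using B strucK iso_refl unfolding K0_def by blast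
  define E where "E = {(n, \<phi>). \<phi> \<in> image_diag L_PF \<Phi> (Z n)}"
  have sec: "enum_section E n = diag L (B n)" for n
    unfolding enum_section_def E_def using B(2) by auto
  have "is_class L K0"
    unfolding is_class_def K0_def using iso_trans by blast
  moreover have "K0 \<subseteq> K"
    using assms B(1) unfolding K0_def is_class_def by blast
  moreover have "infinite (K0 // iso_rel K0)"
  proof -
    have "inj (\<lambda>n. iso_rel K0 `` {B n})"
    proof (rule injI)
      fix m n assume "iso_rel K0 `` {B m} = iso_rel K0 `` {B n}"
      moreover have "B n \<in> iso_rel K0 `` {B n}" using BK0 iso_refl by (auto simp: iso_rel_def)
      ultimately have "iso (B m) (B n)" by (auto simp: iso_rel_def)
      then show "m = n" by (rule iso_B)
    qed
    then have "infinite (range (\<lambda>n. iso_rel K0 `` {B n}))" using finite_imageD infinite_UNIV_nat by blast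
    moreover have "range (\<lambda>n. iso_rel K0 `` {B n}) \<subseteq> K0 // iso_rel K0"
      using BK0 by (auto intro: quotientI)
    ultimately show ?thesis using finite_subset by blast
  qed
  moreover have "friedberg_enumeration L K0 E"
  proof -
    \<comment> \<open>Here \<open>s\<close> codes the left side \<alpha> of a pair in \<Phi>,
      faithfully since \<alpha> is finite, and the bounded quantifier expresses that \<alpha> lies
      in the diagram. The prime has its own quantifier because \<open>nth_prime\<close> enters only
      through its graph.\<close>
    have code: "(\<lambda>(n, \<phi>). prod_encode (n, lit_code \<phi>)) ` E =
      {x. \<exists>n l p s. x = prod_encode (n, l) \<and> p = nth_prime n \<and> prod_encode (s, l) \<in> W \<and>
         (\<forall>k<s. k \<notin> set_decode s \<or> k \<in> lit_code ` diag L_PF (Zp p))}" (is "?I = ?J")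
    proof (intro set_eqI iffI)
      fix x assume "x \<in> ?I"
      then obtain n \<alpha> \<phi> where x: "x = prod_encode (n, lit_code \<phi>)" and \<alpha>: "\<alpha> \<subseteq> diag L_PF (Z n)" "(\<alpha>, \<phi>) \<in> \<Phi>"
        unfolding E_def image_diag_def by auto
      have "set_decode (litset_code \<alpha>) \<subseteq> lit_code ` diag L_PF (Z n)"
        using \<alpha>(1) by (auto simp: set_decode_litset_code[OF fin[OF \<alpha>(2)]] simp del: lit_code.simps)
      moreover have "prod_encode (litset_code \<alpha>, lit_code \<phi>) \<in> W"
        unfolding W_def using \<alpha>(2) by (auto intro!: rev_image_eqI simp del: lit_code.simps)
      ultimately show "x \<in> ?J" unfolding set_decode_subset_iff Z_def using x by blast
    next
      fix x assume "x \<in> ?J"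
      then obtain n l s where x: "x = prod_encode (n, l)" "prod_encode (s, l) \<in> W"
        "set_decode s \<subseteq> lit_code ` diag L_PF (Z n)"
        unfolding set_decode_subset_iff Z_def by blast
      then obtain \<alpha> \<phi> where \<alpha>: "(\<alpha>, \<phi>) \<in> \<Phi>" "s = litset_code \<alpha>" "l = lit_code \<phi>"
        unfolding W_def by (auto simp del: lit_code.simps)
      have "\<alpha> \<subseteq> diag L_PF (Z n)"
        using x(3) by (simp add: \<alpha>(2) set_decode_litset_code[OF fin[OF \<alpha>(1)]] inj_image_subset_iff[OF inj_lit_code])
      then have "(n, \<phi>) \<in> E" using \<alpha>(1) unfolding E_def image_diag_def by blast
      then show "x \<in> ?I" using x(1) \<alpha>(3) by force
    qed
    have "ce ((\<lambda>(n, \<phi>). prod_encode (n, lit_code \<phi>)) ` E)"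
      unfolding code
    proof (rule ceI)
      show "re 1 (\<lambda>e. e 0 \<in> ?J)"
        unfolding mem_Collect_eq
        by (intro re_intros re_nth_prime re_ce[OF W] re_not_mem_set_decode re_diag_Zp computable_intros) simp_all
    qed
    moreover have "\<exists>n. \<exists>C\<in>K0. enum_section E n = diag L C \<and> iso C A" if "A \<in> K0" for A
      using that sec BK0 unfolding K0_def by blast
    moreover have "n = m" if "A \<in> K0" "C \<in> K0" "enum_section E n = diag L A" "enum_section E m = diag L C" "iso A C" for n m A C
    proof -
      \<comment> \<open>Equal diagrams give equal structures, so the members of \<open>K0\<close>
        named by these sections are the chosen ones.\<close>
      have "A = B n" "C = B m"
        using that diag_inj[of L "B n" A] diag_inj[of L "B m" C] sec strucK[OF B(1)] unfolding K0_def by auto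
      then show ?thesis using that iso_B by blast
    qed
    ultimately show ?thesis
      unfolding friedberg_enumeration_def comp_enumeration_def
      by (intro conjI allI ballI impI) (use sec BK0 in blast)+
  qed
  ultimately show "\<exists>K0. is_class L K0 \<and> K0 \<subseteq> K \<and> infinite (K0 // iso_rel K0) \<and>
          (\<exists>E. friedberg_enumeration L K0 E)" by blast
next

  \<comment> \<open>From a Friedberg enumeration to an embedding\<close>
  assume "\<exists>K0. is_class L K0 \<and> K0 \<subseteq> K \<and> infinite (K0 // iso_rel K0) \<and>
          (\<exists>E. friedberg_enumeration L K0 E)"
  then obtain K0 E where K0: "K0 \<subseteq> K" and fr: "friedberg_enumeration L K0 E" by blast
  have strucK: "is_struc L A" if "A \<in> K" for A
    using assms that unfolding is_class_def by blast
  define W where "W = (\<lambda>(n, \<phi>). prod_encode (n, lit_code \<phi>)) ` E"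
  have W: "ce W" and sec: "\<And>n. \<exists>A\<in>K0. enum_section E n = diag L A"
    using fr unfolding friedberg_enumeration_def comp_enumeration_def W_def by auto
  obtain B where B: "\<And>n. B n \<in> K0" "\<And>n. enum_section E n = diag L (B n)"
    using sec by metis
  have iso_B: "n = m" if "iso (B n) (B m)" for n m
    using fr B that unfolding friedberg_enumeration_def by blast
  \<comment> \<open>Any certificate for \<open>p\<close> releases the whole section \<open>p\<close>
    of \<open>E\<close>. Sections are indexed by the prime itself, since distinct indices already
    name non-isomorphic structures.\<close>
  define \<Phi> where "\<Phi> = {(char_cert (nth_code u) p, \<phi>) | u p \<phi>. prime p \<and> (p, \<phi>) \<in> E}"
  have img: "image_diag L_PF \<Phi> A = diag L (B p)" if A: "A \<in> PF" "iso A (Zp p)" for A p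
  proof -
    have "prime p"
    proof -
      obtain q where q: "prime q" "iso A (Zp q)" using PF_E[OF A(1)] by blast
      have "q = p" by (rule iso_Zp_imp_eq) (use q(2) A(2) iso_sym iso_trans in blast)
      then show ?thesis using q by blast
    qed
    obtain u where "char_cert (nth_code u) p \<subseteq> diag L_PF A" using char_cert_exists[OF A] by blast
    \<comment> \<open>Some certificate for \<open>p\<close> lies in the diagram of \<open>A\<close>
      and none for another prime does, so exactly section \<open>p\<close> is released.\<close>
    then have "image_diag L_PF \<Phi> A = enum_section E p"
      using \<open>prime p\<close> char_cert_subset_diag_imp_eq[OF A]
      unfolding image_diag_def \<Phi>_def enum_section_def by blast
    then show ?thesis using B(2) by simp
  qed
  have code: "(\<lambda>(\<alpha>, \<phi>). prod_encode (litset_code \<alpha>, lit_code \<phi>)) ` \<Phi> =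
    {x. \<exists>s l u p. x = prod_encode (s, l) \<and> s = litset_code (char_cert (nth_code u) p) \<and>
        prime p \<and> prod_encode (p, l) \<in> W}" (is "?I = ?J")
  proof (intro set_eqI iffI)
    fix x assume "x \<in> ?I"
    then obtain u p \<phi> where x: "x = prod_encode (litset_code (char_cert (nth_code u) p), lit_code \<phi>)"
      "prime p" and \<phi>: "(p, \<phi>) \<in> E"
      unfolding \<Phi>_def by (auto simp del: lit_code.simps)
    have "prod_encode (p, lit_code \<phi>) \<in> W"
      unfolding W_def by (rule rev_image_eqI[OF \<phi>]) simp
    then show "x \<in> ?J" using x by blast
  next
    fix x assume "x \<in> ?J"
    then obtain u p \<phi> where x: "x = prod_encode (litset_code (char_cert (nth_code u) p), lit_code \<phi>)"
      and "prime p" "(p, \<phi>) \<in> E"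
      unfolding W_def by (auto simp del: lit_code.simps)
    then have "(char_cert (nth_code u) p, \<phi>) \<in> \<Phi>" unfolding \<Phi>_def by blast
    then show "x \<in> ?I" by (rule rev_image_eqI) (simp add: x)
  qed
  have "comp_transformation L_PF PF L K \<Phi>"
    unfolding comp_transformation_def
  proof (intro conjI)
    show "ce ((\<lambda>(\<alpha>, \<phi>). prod_encode (litset_code \<alpha>, lit_code \<phi>)) ` \<Phi>)"
      unfolding code
    proof (rule ceI)
      show "re 1 (\<lambda>e. e 0 \<in> ?J)"
        unfolding mem_Collect_eq
        by (intro re_intros re_litset_code_char_cert re_prime re_ce[OF W] computable_intros) simp_all
    qed
    have "is_atom L UNIV (snd \<phi>)" if "(p, \<phi>) \<in> E" for p \<phi>
    proof -
      have "\<phi> \<in> diag L (B p)" using that B(2)[of p] unfolding enum_section_def by blast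
      then have "is_atom L (univ (B p)) (snd \<phi>)" unfolding diag_def by auto
      then show ?thesis by (cases "snd \<phi>") auto
    qed
    then show "\<forall>(\<alpha>, \<phi>)\<in>\<Phi>. finite \<alpha> \<and> (\<exists>B. is_struc L_PF B \<and> finite (univ B) \<and> \<alpha> \<subseteq> diag L_PF B) \<and>
        is_atom L UNIV (snd \<phi>)"
      unfolding \<Phi>_def using finite_char_cert char_cert_in_finite_struc by fast
    show "\<forall>A\<in>PF. \<exists>B\<in>K. image_diag L_PF \<Phi> A = diag L B"
      using img B(1) K0 by (meson PF_E subsetD)
  qed
  moreover have "iso A A' \<longleftrightarrow> iso C C'" if A: "A \<in> PF" "A' \<in> PF" and C: "C \<in> K" "C' \<in> K"
    "image_diag L_PF \<Phi> A = diag L C" "image_diag L_PF \<Phi> A' = diag L C'" for A A' C C'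
  proof -
    obtain p where p: "iso A (Zp p)" using PF_E[OF A(1)] by blast
    obtain q where q: "iso A' (Zp q)" using PF_E[OF A(2)] by blast
    have strucB: "is_struc L (B n)" for n using strucK B(1) K0 by blast
    \<comment> \<open>With the images identified, both isomorphism statements reduce to
      \<open>p = q\<close>: for the fields by cardinality, for the images by the Friedberg
      property.\<close>
    have "C = B p" "C' = B q"
      using C img[OF A(1) p] img[OF A(2) q] strucK strucB by (auto intro!: diag_inj[of L])
    moreover have "iso A A' \<longleftrightarrow> p = q"
      using p q iso_sym iso_trans iso_Zp_imp_eq by metis
    ultimately show ?thesis using iso_B iso_refl by auto
  qed
  ultimately show "comp_reducible L_PF PF L K"
    unfolding comp_reducible_def comp_embedding_def
    by (intro exI[of _ \<Phi>] conjI ballI impI)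
qed

end
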